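(* Let $S=\{x^2+c_1,\dots,x^2+c_s\}$ be a set of quadratic polynomials with $c_i\in\mathbb{Q}$, let $\nu$ be a strictly positive probability measure on $S$, and let $\bar\nu=\nu^{\mathbb{N}}$ be the product measure on $\Phi_S=S^{\mathbb{N}}$. Then: (1) If $\mathrm{Orb}_S(0)$ contains a finite orbit point for $S$, then $S$ is one of \[\{x^2\},\ \{x^2-1\},\ \{x^2-2\},\ \{x^2,\,x^2-1\},\ \{x^2-2,\,x^2-3\},\ \{x^2-2,\,x^2-6\}.\] (2) Let $\Phi_S^{\mathrm{sep}}\subseteq\Phi_S$ be the set of sequences $\gamma$ such that $\gamma_n$ is separable for all $n$. If $S$ is one of the six sets in (1), then \[\bar\nu\big(\{\gamma\in\Phi_S^{\mathrm{sep}}: [\mathrm{Aut}(T_\gamma):G_{\gamma,\mathbb{Q}}]<\infty\}\big)=0.\] In particular, if $\mathrm{Orb}_S(0)$ contains a finite orbit point for $S$, then a $\bar\nu$-random sequence $\gamma$ furnishes a finite index arboreal representation with probability zero.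
   Context: A probability measure $\nu$ on the finite set $S$ is strictly positive if $\nu(\phi)>0$ for all $\phi\in S$. Let $M_S$ be the monoid generated by $S$ under composition (including the identity). For a point $P$, $\mathrm{Orb}_S(P)=\{f(P): f\in M_S\}$; $P$ is a finite orbit point for $S$ if $\mathrm{Orb}_S(P)$ is finite. For $\gamma=(\theta_1,\theta_2,\dots)\in\Phi_S$ set $\gamma_n=\theta_1\circ\cdots\circ\theta_n$. For a field $K$, $K_n(\gamma)$ is the splitting field of $\gamma_n$ over $K$ in a fixed algebraic closure (with $K_0(\gamma)=K$), $G_{\gamma,n,K}=\mathrm{Gal}(K_n(\gamma)/K)$, and $G_{\gamma,K}=\varprojlim_n G_{\gamma,n,K}$ (restriction maps). The preimage tree $T_\gamma$ has vertex set $\{0\}\cup\{\alpha\in\overline K: \gamma_m(\alpha)=0\text{ for some }m\ge1\}$, with an edge between $\alpha$ and $\theta_m(\alpha)$ whenever $\gamma_m(\alpha)=0$; for separable $\gamma$ the group $G_{\gamma,K}$ acts faithfully on $T_\gamma$ by tree automorphisms, giving an embedding $G_{\gamma,K}\le\mathrm{Aut}(T_\gamma)$ (the arboreal representation). *)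

theory Defs
  imports
    "HOL-Probability.Probability"
    "HOL-Algebra.Algebraic_Closure_Type"
    "HOL-Algebra.Generated_Fields"
    "HOL-Algebra.Product_Groups"
    "HOL-Algebra.Bij"
begin

section \<open>Orbits under the monoid generated by a set of polynomials\<close>

inductive_set comp_monoid :: "'a::comm_ring_1 poly set \<Rightarrow> 'a poly set"
  for S :: "'a poly set" where
  ident: "[:0, 1:] \<in> comp_monoid S"
| gen: "f \<in> S \<Longrightarrow> f \<in> comp_monoid S"
| comp: "f \<in> comp_monoid S \<Longrightarrow> g \<in> comp_monoid S \<Longrightarrow> f \<circ>\<^sub>p g \<in> comp_monoid S"

definition Orb :: "'a::comm_ring_1 poly set \<Rightarrow> 'a \<Rightarrow> 'a set" where
  "Orb S P = {poly f P | f. f \<in> comp_monoid S}"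

definition finite_orbit_point :: "'a::comm_ring_1 poly set \<Rightarrow> 'a \<Rightarrow> bool" where
  "finite_orbit_point S P \<longleftrightarrow> finite (Orb S P)"

section \<open>Sequences of polynomials\<close>

text \<open>
  A sequence $(\theta_1, \theta_2, \ldots)$ is a function \<open>\<gamma>\<close> on the natural numbers with
  $\theta_{n+1}$ = \<open>\<gamma> n\<close>, and \<open>seq_comp \<gamma> n\<close> is $\gamma_n = \theta_1 \circ \cdots \circ \theta_n$
  (with $\gamma_0$ the identity).
\<close>

primrec seq_comp :: "(nat \<Rightarrow> 'a::comm_ring_1 poly) \<Rightarrow> nat \<Rightarrow> 'a poly" where
  "seq_comp \<gamma> 0 = [:0, 1:]"
| "seq_comp \<gamma> (Suc n) = seq_comp \<gamma> n \<circ>\<^sub>p \<gamma> n"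

text \<open>
  The base field is the whole type \<open>'a\<close>; its fixed algebraic closure is \<open>'a alg_closure\<close>, into
  which it embeds by \<open>to_ac\<close>.
\<close>

definition ac_roots :: "'a::field poly \<Rightarrow> 'a alg_closure set" where
  "ac_roots f = {\<alpha>. poly (map_poly to_ac f) \<alpha> = 0}"

definition separable_poly :: "'a::field poly \<Rightarrow> bool" where
  "separable_poly f \<longleftrightarrow> rsquarefree (map_poly (to_ac :: 'a \<Rightarrow> 'a alg_closure) f)"

definition Phi_sep :: "'a::field poly set \<Rightarrow> (nat \<Rightarrow> 'a poly) set" where
  "Phi_sep S = {\<gamma> \<in> UNIV \<rightarrow> S. \<forall>n. separable_poly (seq_comp \<gamma> n)}"

section \<open>Galois groups\<close>

definition splitting_field :: "'a::field poly \<Rightarrow> 'a alg_closure set" where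
  "splitting_field f = generate_field ring_of_type_algebra (range to_ac \<union> ac_roots f)"

text \<open>
  $\mathrm{Gal}(L/K)$ for a field $L$ between $K$ and its algebraic closure. Automorphisms are
  extensional functions, i.e. \<open>undefined\<close> outside $L$.
\<close>

definition Gal :: "'a::field alg_closure set \<Rightarrow> ('a alg_closure \<Rightarrow> 'a alg_closure) monoid" where
  "Gal L = (BijGroup L)
     \<lparr>carrier := {\<sigma> \<in> Bij L.
        \<sigma> \<in> ring_iso (ring_of_type_algebra\<lparr>carrier := L\<rparr>) (ring_of_type_algebra\<lparr>carrier := L\<rparr>)
        \<and> (\<forall>a. \<sigma> (to_ac a) = to_ac a)}\<rparr>"

definition Gal_n :: "(nat \<Rightarrow> 'a::field poly) \<Rightarrow> nat \<Rightarrow> ('a alg_closure \<Rightarrow> 'a alg_closure) monoid" where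
  "Gal_n \<gamma> n = Gal (splitting_field (seq_comp \<gamma> n))"

text \<open>The inverse limit along the restriction maps, as a subgroup of the product.\<close>

definition Gal_lim :: "(nat \<Rightarrow> 'a::field poly) \<Rightarrow> (nat \<Rightarrow> 'a alg_closure \<Rightarrow> 'a alg_closure) monoid" where
  "Gal_lim \<gamma> = (product_group UNIV (Gal_n \<gamma>))
     \<lparr>carrier := {\<sigma> \<in> carrier (product_group UNIV (Gal_n \<gamma>)).
        \<forall>m n. m \<le> n \<longrightarrow> restrict (\<sigma> n) (splitting_field (seq_comp \<gamma> m)) = \<sigma> m}\<rparr>"

section \<open>The preimage tree and the arboreal representation\<close>

definition tree_verts :: "(nat \<Rightarrow> 'a::field poly) \<Rightarrow> 'a alg_closure set" where
  "tree_verts \<gamma> = {0} \<union> {\<alpha>. \<exists>m\<ge>1. \<alpha> \<in> ac_roots (seq_comp \<gamma> m)}"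

definition tree_edges :: "(nat \<Rightarrow> 'a::field poly) \<Rightarrow> 'a alg_closure set set" where
  "tree_edges \<gamma> =
     {{\<alpha>, poly (map_poly to_ac (\<gamma> m)) \<alpha>} | \<alpha> m. \<alpha> \<in> ac_roots (seq_comp \<gamma> (Suc m))}"

text \<open>
  It is not required separately that the root \<open>0\<close> be fixed: when the roots of the various
  $\gamma_m$ are distinct, \<open>0\<close> is the only vertex of degree 2 of a binary tree whose other vertices
  all have degree 3.
\<close>

definition tree_Aut :: "(nat \<Rightarrow> 'a::field poly) \<Rightarrow> ('a alg_closure \<Rightarrow> 'a alg_closure) monoid" where
  "tree_Aut \<gamma> = (BijGroup (tree_verts \<gamma>))
     \<lparr>carrier := {f \<in> Bij (tree_verts \<gamma>).
        \<forall>\<alpha>\<in>tree_verts \<gamma>. \<forall>\<beta>\<in>tree_verts \<gamma>.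
          {\<alpha>, \<beta>} \<in> tree_edges \<gamma> \<longleftrightarrow> {f \<alpha>, f \<beta>} \<in> tree_edges \<gamma>}\<rparr>"

text \<open>
  An element $(\sigma_n)_n$ of the inverse limit sends a root \<open>\<alpha>\<close> of $\gamma_m$ to $\sigma_m(\alpha)$.
  By compatibility with restriction the value is the same for all such \<open>m\<close>; the least one is
  used (for the root \<open>0\<close> of the tree this is \<open>m = 0\<close>, and $\sigma_0(0) = 0$).
\<close>

definition arboreal_rep ::
  "(nat \<Rightarrow> 'a::field poly) \<Rightarrow> (nat \<Rightarrow> 'a alg_closure \<Rightarrow> 'a alg_closure) \<Rightarrow> 'a alg_closure \<Rightarrow> 'a alg_closure"
  where
  "arboreal_rep \<gamma> \<sigma> =
     (\<lambda>\<alpha>\<in>tree_verts \<gamma>. \<sigma> (LEAST m. \<alpha> \<in> ac_roots (seq_comp \<gamma> m)) \<alpha>)"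

definition arboreal_image :: "(nat \<Rightarrow> 'a::field poly) \<Rightarrow> ('a alg_closure \<Rightarrow> 'a alg_closure) set" where
  "arboreal_image \<gamma> = arboreal_rep \<gamma> ` carrier (Gal_lim \<gamma>)"

definition finite_index_arboreal :: "(nat \<Rightarrow> 'a::field poly) \<Rightarrow> bool" where
  "finite_index_arboreal \<gamma> \<longleftrightarrow> finite (rcosets\<^bsub>tree_Aut \<gamma>\<^esub> (arboreal_image \<gamma>))"

section \<open>The polynomials $x^2 + c$\<close>

definition quad :: "'a::comm_ring_1 \<Rightarrow> 'a poly" where
  "quad c = [:c, 0, 1:]"

definition special_sets :: "rat poly set set" where
  "special_sets =
     {{quad 0}, {quad (- 1)}, {quad (- 2)},
      {quad 0, quad (- 1)}, {quad (- 2), quad (- 3)}, {quad (- 2), quad (- 6)}}"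

end

theory Submission
  imports Defs
begin

text \<open>
  (1) Let \<open>O\<close> be the finite orbit of \<open>P\<close>. If a prime divides the denominator of some \<open>c \<in> C\<close>, then on
  \<open>O\<close> its exponent in the denominator must be exactly half of the one in \<open>c\<close>, whereas on the orbit of
  \<open>0\<close> it is either zero or at least the one in \<open>c\<close>; so \<open>C\<close> consists of integers. If \<open>B\<close> is the maximal
  absolute value on \<open>O\<close>, then \<open>- B - B\<^sup>2 \<le> c \<le> B - B\<^sup>2\<close>, and integers beyond \<open>B\<close> never return to
  \<open>[- B, B]\<close>, which leaves only \<open>B \<le> 2\<close>.

  (2) If \<open>S\<close> contains $x^2 - 2$, then $\gamma_n(0)$ lies in a finite set whenever $\theta_n = x^2 - 2$.
  The product $D_n$ of chosen square roots of $\alpha - c_{n+1}$ over all roots $\alpha$ of $\gamma_n$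
  satisfies $D_n^2 = \gamma_{n+1}(0)$, so if this happens infinitely often then $D_n$ takes, up to sign, the same
  value for infinitely many \<open>n\<close>, and Galois elements act on all of these by a common sign. Tree automorphisms
  can flip the sign of each $D_n$ separately, so the index is infinite. (The levels of the tree are disjoint
  because each $\gamma_n$ is irreducible by Eisenstein's criterion at 2.) Finite index therefore forces
  $\theta_n = x^2 - 2$ for only finitely many \<open>n\<close>, which leaves countably many sequences. If \<open>S\<close> consists of $x^2$ and $x^2 - 1$, or one
  of them, then separability leaves at most one sequence.
\<close>

section \<open>Finite orbit points\<close>

lemma poly_quad [simp]: "poly (quad c) x = x^2 + c"
  by (simp add: quad_def power2_eq_square)

lemma quad_eq_iff [simp]: "quad a = quad b \<longleftrightarrow> a = b"
  by (simp add: quad_def)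

lemma Orb_refl: "P \<in> Orb S P"
  unfolding Orb_def by (auto intro!: exI[of _ "[:0, 1:]"] comp_monoid.ident)

lemma Orb_step: "x \<in> Orb S P \<Longrightarrow> \<phi> \<in> S \<Longrightarrow> poly \<phi> x \<in> Orb S P"
  proof -
  assume "x \<in> Orb S P" "\<phi> \<in> S"
  then obtain f where "f \<in> comp_monoid S" "x = poly f P" by (auto simp: Orb_def)
  with \<open>\<phi> \<in> S\<close> have "\<phi> \<circ>\<^sub>p f \<in> comp_monoid S" "poly \<phi> x = poly (\<phi> \<circ>\<^sub>p f) P"
    by (auto simp: poly_pcompose intro: comp_monoid.gen comp_monoid.comp)
  then show ?thesis unfolding Orb_def by blast
qed

lemma Orb_subset_invariant:
  assumes "P \<in> J" and "\<And>\<phi> x. \<phi> \<in> S \<Longrightarrow> x \<in> J \<Longrightarrow> poly \<phi> x \<in> J"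
  shows "Orb S P \<subseteq> J"
proof -
  have "\<forall>x\<in>J. poly f x \<in> J" if "f \<in> comp_monoid S" for f
    using that by induction (auto simp: poly_pcompose assms(2))
  with assms(1) show ?thesis by (auto simp: Orb_def)
qed

section \<open>The exponent of a prime in a denominator, max(0, -v_p(x))\<close>

definition denom_exp :: "int \<Rightarrow> rat \<Rightarrow> nat" where
  "denom_exp p x = multiplicity p (snd (quotient_of x))"

text \<open>Any fraction a/(p^k m) with \<open>m\<close> prime to \<open>p\<close> will do, provided
  that \<open>p\<close> does not cancel; sums and squares need not be reduced to lowest
  terms.\<close>

lemma denom_exp_eqI:
  assumes p: "Factorial_Ring.prime p" and m: "\<not> p dvd m" and a: "k = 0 \<or> \<not> p dvd a"
    and x: "x * of_int (p ^ k * m) = of_int a"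
  shows "denom_exp p x = k"
proof -
  obtain u v where uv: "quotient_of x = (u, v)" by fastforce
  have v: "v > 0" and cop: "coprime u v" and xuv: "x = of_int u / of_int v"
    using uv quotient_of_denom_pos quotient_of_coprime quotient_of_div by blast+
  have "of_int (a * v) = (of_int (u * (p ^ k * m)) :: rat)"
    using x v by (simp add: xuv field_simps)
  then have av: "a * v = u * (p ^ k * m)"
    by (simp only: of_int_eq_iff)
  have "p ^ k dvd v"
  proof (cases "k = 0")
    case False
    with a p have "coprime (p ^ k) a" by (simp add: prime_imp_coprime)
    moreover have "p ^ k dvd a * v" unfolding av by simp
    ultimately show ?thesis by (simp add: coprime_dvd_mult_right_iff)
  qed simp
  then obtain w where w: "v = p ^ k * w" by blast
  have "p ^ k * (a * w) = p ^ k * (u * m)" using av w by (simp add: mult_ac)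
  then have aw: "a * w = u * m" using p by (simp add: prime_gt_0_int)
  have "\<not> p dvd w"
  proof
    assume pw: "p dvd w"
    then have "p dvd u * m" by (metis aw dvd_mult)
    with p m have "p dvd u" by (simp add: prime_dvd_mult_iff)
    moreover have "p dvd v" using pw w by simp
    ultimately show False using cop p by (meson coprime_common_divisor not_prime_unit)
  qed
  then show ?thesis
    using w p v uv by (simp add: denom_exp_def multiplicity_eqI prime_elem_multiplicity_mult_distrib
        multiplicity_prime_power not_dvd_imp_multiplicity_0 multiplicity_times_same)
qed

lemma denom_expE:
  assumes p: "Factorial_Ring.prime p"
  obtains a m where "\<not> p dvd m" "denom_exp p x = 0 \<or> \<not> p dvd a"
    "x * of_int (p ^ denom_exp p x * m) = of_int a"
proof -
  obtain u v where uv: "quotient_of x = (u, v)" by fastforce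
  have v: "v > 0" and cop: "coprime u v" and xuv: "x = of_int u / of_int v"
    using uv quotient_of_denom_pos quotient_of_coprime quotient_of_div by blast+
  obtain m where m: "v = p ^ multiplicity p v * m" "\<not> p dvd m"
    using multiplicity_decompose'[of v p] v p by (metis less_irrefl not_prime_unit)
  have ee: "denom_exp p x = multiplicity p v" by (simp add: denom_exp_def uv)
  have "multiplicity p v = 0 \<or> \<not> p dvd u"
    using cop p by (metis coprime_common_divisor not_dvd_imp_multiplicity_0 not_prime_unit)
  moreover have "x * of_int (p ^ denom_exp p x * m) = of_int u"
    unfolding ee m(1)[symmetric] using v by (simp add: xuv)
  ultimately show ?thesis using that[of m u] m(2) ee by metis
qed

lemma denom_exp_power2:
  assumes p: "Factorial_Ring.prime p" shows "denom_exp p (x^2) = 2 * denom_exp p x"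
proof -
  obtain a m where am: "\<not> p dvd m" "denom_exp p x = 0 \<or> \<not> p dvd a"
    "x * of_int (p ^ denom_exp p x * m) = of_int a" using denom_expE[OF p] by metis
  have "x^2 * of_int (p ^ (2 * denom_exp p x) * m^2) = (x * of_int (p ^ denom_exp p x * m))^2"
    by (simp add: power_mult_distrib power_even_eq)
  also have "\<dots> = of_int (a^2)" by (simp only: am(3)) simp
  finally show ?thesis using am p
    by (intro denom_exp_eqI[of p "m^2" _ "a^2"]) (auto simp: prime_dvd_power_iff)
qed

text \<open>The ultrametric equality: over the common denominator, the share of \<open>x\<close> in
  the numerator keeps a factor \<open>p\<close>, while that of \<open>y\<close> is prime to
  \<open>p\<close>.\<close>

lemma denom_exp_add:
  assumes p: "Factorial_Ring.prime p" and less: "denom_exp p x < denom_exp p y"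
  shows "denom_exp p (x + y) = denom_exp p y" "denom_exp p (y + x) = denom_exp p y"
proof -
  obtain a m where am: "\<not> p dvd m" "denom_exp p x = 0 \<or> \<not> p dvd a"
    "x * of_int (p ^ denom_exp p x * m) = of_int a" using denom_expE[OF p] by metis
  obtain b n where bn: "\<not> p dvd n" "denom_exp p y = 0 \<or> \<not> p dvd b"
    "y * of_int (p ^ denom_exp p y * n) = of_int b" using denom_expE[OF p] by metis
  define d where "d = denom_exp p y - denom_exp p x"
  have d: "denom_exp p y = denom_exp p x + d" "d > 0" using less by (auto simp: d_def)
  have "(x + y) * of_int (p ^ denom_exp p y * (m * n)) =
     (x * of_int (p ^ denom_exp p x * m)) * of_int (p ^ d * n) +
     (y * of_int (p ^ denom_exp p y * n)) * of_int m"
    unfolding d by (simp add: algebra_simps power_add)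
  also have "\<dots> = of_int (a * (p ^ d * n) + b * m)" by (simp only: am(3) bn(3)) simp
  finally have *: "(x + y) * of_int (p ^ denom_exp p y * (m * n)) = of_int (a * (p ^ d * n) + b * m)" .
  have "p dvd a * (p ^ d * n)" using d(2) by (simp add: dvd_mult dvd_mult2 dvd_power)
  then have "\<not> p dvd a * (p ^ d * n) + b * m"
    using bn am p less by (auto simp: dvd_add_right_iff prime_dvd_mult_iff)
  then show "denom_exp p (x + y) = denom_exp p y"
    using am(1) bn(1) p * by (intro denom_exp_eqI[of p "m * n"]) (auto simp: prime_dvd_mult_iff)
  then show "denom_exp p (y + x) = denom_exp p y" by (simp add: add.commute)
qed

lemma denom_exp_eq_0_imp_Ints:
  assumes "\<And>p. Factorial_Ring.prime p \<Longrightarrow> denom_exp p x = 0"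
  shows "x \<in> \<int>"
proof -
  obtain u v where uv: "quotient_of x = (u, v)" by fastforce
  have v: "v > 0" and xuv: "x = of_int u / of_int v"
    using uv quotient_of_denom_pos quotient_of_div by blast+
  have "v = 1"
  proof (rule ccontr)
    assume "v \<noteq> 1"
    then obtain p where "Factorial_Ring.prime p" "p dvd v"
      using v prime_factor_int[of v] by auto
    then show False
      using assms[of p] v uv by (auto simp: denom_exp_def multiplicity_eq_zero_iff)
  qed
  then show ?thesis by (simp add: xuv)
qed

lemma finite_orbit_imp_Ints:
  fixes C :: "rat set"
  assumes fin: "finite_orbit_point (quad ` C) P" and P: "P \<in> Orb (quad ` C) 0" and c: "c \<in> C"
  shows "c \<in> \<int>"
proof (rule denom_exp_eq_0_imp_Ints, rule ccontr)
  fix p :: int assume p: "Factorial_Ring.prime p" and c0: "denom_exp p c \<noteq> 0"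
  let ?e = "denom_exp p"
  define O' where "O' = Orb (quad ` C) P"
  have fO: "finite O'" using fin by (simp add: O'_def finite_orbit_point_def)
  have PO: "P \<in> O'" by (simp add: O'_def Orb_refl)
  have step: "x^2 + d \<in> O'" if "x \<in> O'" "d \<in> C" for x d
    using Orb_step[of x "quad ` C" P "quad d"] that by (simp add: O'_def)
  define M where "M = Max (?e ` O')"
  have leM: "?e x \<le> M" if "x \<in> O'" for x using that fO by (simp add: M_def)
  obtain z where z: "z \<in> O'" "?e z = M"
    using Max_in[of "?e ` O'"] fO PO unfolding M_def by (metis empty_iff finite_imageI image_iff image_is_empty)
  have big: "?e (x^2 + d) = 2 * ?e x" if "?e d < 2 * ?e x" for x d
    using denom_exp_add(2)[OF p, of d "x^2"] that by (simp add: denom_exp_power2[OF p])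
  have small: "?e (x^2 + d) = ?e d" if "2 * ?e x < ?e d" for x d
    using denom_exp_add(1)[OF p, of "x^2" d] that by (simp add: denom_exp_power2[OF p])
  \<comment> \<open>The maximum \<open>M\<close> is attained at \<open>z\<close>. If the exponent of
    \<open>d\<close> were below 2M, then z^2 + d would have exponent 2M, more than \<open>M\<close>
    unless \<open>M\<close> is 0.\<close>
  have M2: "M = 0 \<or> 2 * M \<le> ?e d" if "d \<in> C" for d
    using big[of d z] z leM[OF step[OF z(1) that]] by fastforce
  \<comment> \<open>If the exponent of \<open>c\<close> is the larger one, then x^2 + c inherits it,
    so it is at most \<open>M\<close>, against \<open>M2\<close>.\<close>
  have eq: "2 * ?e x = ?e c" if "x \<in> O'" for x
  proof (rule ccontr)
    assume "2 * ?e x \<noteq> ?e c"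
    then have "2 * ?e x < ?e c" using leM[OF that] M2[OF c] c0 by fastforce
    from small[OF this] have "?e c \<le> M" using leM[OF step[OF that c]] by simp
    then show False using M2[OF c] c0 by simp
  qed
  have M0: "M > 0" using eq[OF z(1)] z(2) c0 by simp
  have ge: "2 * M \<le> ?e d" if "d \<in> C" for d using M2[OF that] M0 by simp
  have eqd: "?e d = 2 * M" if "d \<in> C" for d
  proof (rule ccontr)
    assume "?e d \<noteq> 2 * M"
    then have "2 * ?e z < ?e d" using ge[OF that] z by simp
    from small[OF this] have "?e d \<le> M" using leM[OF step[OF z(1) that]] by simp
    then show False using ge[OF that] M0 by simp
  qed
  \<comment> \<open>Exponent 0 goes to exponent 2M, and exponents of at least 2M are doubled. By
    \<open>eq\<close> and \<open>eqd\<close>, however, \<open>P\<close> has exponent exactly M >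
    0.\<close>
  have "Orb (quad ` C) 0 \<subseteq> {y. ?e y = 0 \<or> 2 * M \<le> ?e y}"
  proof (rule Orb_subset_invariant)
    show "0 \<in> {y. ?e y = 0 \<or> 2 * M \<le> ?e y}" by (simp add: denom_exp_def)
  next
    fix \<phi> x assume "\<phi> \<in> quad ` C" and x: "x \<in> {y. ?e y = 0 \<or> 2 * M \<le> ?e y}"
    then obtain d where d: "d \<in> C" "\<phi> = quad d" by blast
    from x show "poly \<phi> x \<in> {y. ?e y = 0 \<or> 2 * M \<le> ?e y}"
      using big[of d x] small[of x d] M0 eqd[OF d(1)] by (auto simp: d(2))
  qed
  then show False using P eq[OF PO] eqd[OF c] M0 by fastforce
qed

text \<open>\<open>Y\<close> stands for the finite orbit of \<open>P\<close>, and \<open>orb\<close>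
  puts \<open>P\<close> into the orbit of 0 in the form of an induction principle. The bound
  \<open>B\<close> on \<open>Y\<close> confines every c, which leaves a finite case check.\<close>

lemma integer_orbit_classification:
  fixes C Y :: "int set"
  assumes fin: "finite Y" and P: "P \<in> Y" and step: "\<And>x c. x \<in> Y \<Longrightarrow> c \<in> C \<Longrightarrow> x^2 + c \<in> Y"
    and ne: "C \<noteq> {}"
    and orb: "\<And>J. 0 \<in> J \<Longrightarrow> (\<And>x c. x \<in> J \<Longrightarrow> c \<in> C \<Longrightarrow> x^2 + c \<in> J) \<Longrightarrow> P \<in> J"
  shows "C \<in> {{0}, {- 1}, {- 2}, {0, - 1}, {- 2, - 3}, {- 2, - 6}}"
proof -
  define B where "B = Max (abs ` Y)"
  have leB: "\<bar>x\<bar> \<le> B" if "x \<in> Y" for x using that fin by (simp add: B_def)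
  obtain z where z: "z \<in> Y" "\<bar>z\<bar> = B"
    using Max_in[of "abs ` Y"] fin P unfolding B_def by (metis empty_iff finite_imageI image_iff image_is_empty)
  have z2: "z^2 = B^2" using z(2) by (metis power2_abs)
  have B0: "B \<ge> 0" using z(2) by simp
  have zc: "B^2 + c \<in> Y" if "c \<in> C" for c using step[OF z(1) that] z2 by simp
  have cle: "B^2 + c \<le> B" and cge: "- B \<le> B^2 + c" if "c \<in> C" for c
    using leB[OF zc[OF that]] by auto
  \<comment> \<open>Since c \<ge> - B - B^2, every x with \<bar>x\<bar> \<ge> B + 1 satisfies x^2 +
    c \<ge> \<bar>x\<bar>. So if each nonzero c starts at distance \<open>k\<close> or more, the
    orbit of 0 never enters the gap between 0 and \<open>k\<close>.\<close>
  have escape: "\<bar>P\<bar> \<ge> k \<or> P = 0" if k: "k > B" "\<And>c. c \<in> C \<Longrightarrow> c = 0 \<or> \<bar>c\<bar> \<ge> k" for k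
  proof -
    have "P \<in> {y. \<bar>y\<bar> \<ge> k \<or> y = 0}"
    proof (rule orb)
      fix x c assume x: "x \<in> {y. \<bar>y\<bar> \<ge> k \<or> y = 0}" and c: "c \<in> C"
      show "x^2 + c \<in> {y. \<bar>y\<bar> \<ge> k \<or> y = 0}"
      proof (cases "x = 0")
        case False
        with x have "\<bar>x\<bar> \<ge> B + 1" "\<bar>x\<bar> \<ge> k" using k(1) by auto
        then have "(B + 1) * \<bar>x\<bar> \<le> \<bar>x\<bar> * \<bar>x\<bar>" by (intro mult_right_mono) auto
        moreover have "\<bar>x\<bar> * \<bar>x\<bar> = x^2" by (simp add: power2_eq_square)
        moreover have "B * (B + 1) \<le> B * \<bar>x\<bar>" using \<open>\<bar>x\<bar> \<ge> B + 1\<close> B0 by (intro mult_left_mono) auto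
        ultimately have "x^2 + c \<ge> \<bar>x\<bar>" using cge[OF c] by (simp add: algebra_simps power2_eq_square)
        then show ?thesis using \<open>\<bar>x\<bar> \<ge> k\<close> by auto
      qed (use k(2)[OF c] in auto)
    qed simp
    then show ?thesis by blast
  qed
  obtain c0 where c0: "c0 \<in> C" using ne by blast
  have B2: "B \<le> 2"
  proof (rule ccontr)
    assume "\<not> B \<le> 2"
    then have B3: "B \<ge> 3" by simp
    have BB: "B * B \<ge> 3 * B" using B3 by (intro mult_right_mono) auto
    \<comment> \<open>For B \<ge> 3 every c is at most B - B^2 \<le> -2B. This forces P = 0, but
      then \<open>c0\<close> lies in \<open>Y\<close> and is below -B.\<close>
    have "\<bar>P\<bar> \<ge> B + 1 \<or> P = 0"
    proof (rule escape)
      fix c assume "c \<in> C"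
      then have "c \<le> - (B + 1)" using cle[of c, unfolded power2_eq_square] BB B3 by linarith
      then show "c = 0 \<or> \<bar>c\<bar> \<ge> B + 1" by arith
    qed simp
    with leB[OF P] have "P = 0" by simp
    with step[OF P c0] have "c0 \<in> Y" by simp
    then have "- B \<le> c0" using leB[of c0] by linarith
    then show False using cle[OF c0, unfolded power2_eq_square] BB B3 by linarith
  qed
  consider "B = 0" | "B = 1" | "B = 2" using B0 B2 by linarith
  then show ?thesis
  proof cases
    case 1
    then have "c = 0" if "c \<in> C" for c using cle[OF that] cge[OF that] by simp
    then have "C = {0}" using c0 by blast
    then show ?thesis by simp
  next
    case 2
    have c3: "c \<in> {0, - 1, - 2}" if "c \<in> C" for c using cle[OF that] cge[OF that] 2 by auto
    \<comment> \<open>With -2 in \<open>C\<close>, 0 is not in \<open>Y\<close> because it would go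
      to -2, and -1 is not in \<open>C\<close> because it would send \<open>z\<close> to 0. Then
      \<open>escape\<close> with k = 2 leaves no place for \<open>P\<close>.\<close>
    have "-2 \<notin> C"
    proof
      assume m2: "-2 \<in> C"
      have X0: "0 \<notin> Y" using step[OF _ m2, of 0] leB[of "-2"] 2 by auto
      have m1: "-1 \<notin> C" using zc[of "-1"] X0 2 by auto
      have "\<bar>P\<bar> \<ge> 2 \<or> P = 0" by (rule escape) (use 2 c3 m1 in fastforce)+
      then show False using leB[OF P] 2 X0 P by auto
    qed
    then have "C \<subseteq> {0, - 1}" using c3 by blast
    then have "C = {0} \<or> C = {- 1} \<or> C = {0, - 1}" using c0 by blast
    then show ?thesis by blast
  next
    case 3
    have abs2: "\<bar>x\<bar> \<le> 2" if "x \<in> Y" for x using leB[OF that] 3 by simp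
    have c3: "c \<in> {- 2, - 3, - 6}" if c: "c \<in> C" for c
    proof -
      have "c \<ge> -6" "c \<le> -2" using cle[OF c] cge[OF c] 3 by auto
      \<comment> \<open>Here \<open>z\<close> is 2 or -2. The constant -5 leads from
        \<open>z\<close> to -1 and on to -4; the constant -4 leads from \<open>z\<close> to 0 and on
        to -4.\<close>
      moreover have "c \<noteq> -5"
        using zc[OF c] step[of "-1" c] abs2[of "-4"] c 3 by auto
      moreover have "c \<noteq> -4"
        using zc[OF c] step[of "0" c] abs2[of "-4"] c 3 by auto
      ultimately show ?thesis by auto
    qed
    \<comment> \<open>The constant -3 sends \<open>z\<close> to 1, and -6 sends 1 to -5.\<close>
    have no: "\<not> (-6 \<in> C \<and> -3 \<in> C)"
      using zc[of "-3"] step[of 1 "-6"] abs2[of "-5"] 3 by auto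
    have "-2 \<in> C"
    proof (rule ccontr)
      assume m2: "-2 \<notin> C"
      have "\<bar>P\<bar> \<ge> 3 \<or> P = 0" by (rule escape) (use 3 c3 m2 in fastforce)+
      then have "P = 0" using abs2[OF P] by auto
      then have "c0 \<in> Y" using step[OF P c0] by simp
      then show False using abs2[of c0] c3[OF c0] m2 c0 by auto
    qed
    then have "C = {- 2} \<or> C = {- 2, - 3} \<or> C = {- 2, - 6}" using c3 no by blast
    then show ?thesis by blast
  qed
qed

lemma finite_orbit_imp_special:
  fixes C :: "rat set"
  assumes "C \<noteq> {}" and fin: "finite_orbit_point (quad ` C) P" and P: "P \<in> Orb (quad ` C) 0"
  shows "quad ` C \<in> special_sets"
proof -
  define D :: "int set" where "D = {n. of_int n \<in> C}"
  have CD: "C = of_int ` D"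
    using finite_orbit_imp_Ints[OF fin P] by (auto simp: D_def elim!: Ints_cases)
  have "Orb (quad ` C) 0 \<subseteq> \<int>"
    by (rule Orb_subset_invariant) (auto simp: CD)
  with P obtain Q where Q: "P = of_int Q" by (auto elim: Ints_cases)
  define Y :: "int set" where "Y = {n. of_int n \<in> Orb (quad ` C) P}"
  have "D \<in> {{0}, {- 1}, {- 2}, {0, - 1}, {- 2, - 3}, {- 2, - 6}}"
  proof (rule integer_orbit_classification)
    show "finite Y"
      using fin finite_vimageI[of "Orb (quad ` C) P" "of_int"]
      by (auto simp: Y_def finite_orbit_point_def vimage_def inj_def)
    show "Q \<in> Y" by (simp add: Y_def Orb_refl flip: Q)
    show "x^2 + c \<in> Y" if "x \<in> Y" "c \<in> D" for x c
      using Orb_step[of "of_int x" "quad ` C" P "quad (of_int c)"] that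
      by (auto simp: Y_def CD)
    show "D \<noteq> {}" using assms(1) by (simp add: CD)
    show "Q \<in> J" if J: "0 \<in> J" "\<And>x c. x \<in> J \<Longrightarrow> c \<in> D \<Longrightarrow> x^2 + c \<in> J" for J
    proof -
      have "Orb (quad ` C) 0 \<subseteq> of_int ` J"
      proof (rule Orb_subset_invariant)
        show "0 \<in> of_int ` J" using J(1) by force
        fix \<phi> x assume "\<phi> \<in> quad ` C" "x \<in> (of_int ` J :: rat set)"
        then obtain n k where "k \<in> D" "\<phi> = quad (of_int k)" "x = of_int n" "n \<in> J"
          by (auto simp: CD)
        then show "poly \<phi> x \<in> of_int ` J"
          using J(2)[of n k] by (auto intro!: image_eqI[of _ _ "n^2 + k"])
      qed
      then show ?thesis using P Q by auto
    qed
  qed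
  moreover have "quad ` C = (\<lambda>n. quad (of_int n)) ` D" by (simp add: CD image_image)
  ultimately have "quad ` C \<in> (`) (\<lambda>n. quad (of_int n)) ` {{0}, {- 1}, {- 2}, {0, - 1}, {- 2, - 3}, {- 2, - 6}}"
    by blast
  then show ?thesis
    by (simp only: image_insert image_empty special_sets_def of_int_0 of_int_1 of_int_minus of_int_numeral)
qed

section \<open>The tree of an iterated quadratic tower\<close>

text \<open>The preimage tree in abstract form: \<open>V n\<close> is its n-th level, and the parent
  of x in \<open>V (Suc n)\<close> is x^2 + c n. By disjointness, 0 occurs only as the root, so
  every vertex has two distinct children.\<close>

locale quadratic_tower =
  fixes c :: "nat \<Rightarrow> 'a::alg_closed_field" and V :: "nat \<Rightarrow> 'a set"
  assumes V_0: "V 0 = {0}"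
    and V_Suc: "V (Suc n) = {x. x^2 + c n \<in> V n}"
    and V_disjoint: "m \<noteq> n \<Longrightarrow> V m \<inter> V n = {}"
    and two_neq_0: "(2::'a) \<noteq> 0"
begin

lemma V_unique: "x \<in> V m \<Longrightarrow> x \<in> V n \<Longrightarrow> m = n"
  using V_disjoint by blast

lemma V_Suc_nonzero: "0 \<notin> V (Suc n)"
  using V_unique[of 0 0 "Suc n"] V_0 by auto

lemma uminus_neq_self: "x \<noteq> 0 \<Longrightarrow> - x \<noteq> (x::'a)"
  using two_neq_0 by (metis add.right_inverse mult_2 mult_eq_0_iff)

text \<open>An arbitrary marking of one child of each vertex; the other child is its
  negative.\<close>

definition branch :: "nat \<Rightarrow> 'a \<Rightarrow> 'a" where
  "branch n \<alpha> = (SOME x. x^2 = \<alpha> - c n)"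

lemma branch_power2: "(branch n \<alpha>)^2 = \<alpha> - c n"
  unfolding branch_def by (rule someI_ex) (rule nth_root_exists, simp)

lemma branch_in_V: "\<alpha> \<in> V n \<Longrightarrow> branch n \<alpha> \<in> V (Suc n)"
  by (simp add: V_Suc branch_power2)

lemma branch_nonzero: "\<alpha> \<in> V n \<Longrightarrow> branch n \<alpha> \<noteq> 0"
  using branch_in_V V_Suc_nonzero by metis

lemma inj_on_branch: "inj_on (branch n) A"
  by (rule inj_on_inverseI[of _ "\<lambda>x. x^2 + c n"]) (simp add: branch_power2)

lemma V_Suc_eq: "V (Suc n) = branch n ` V n \<union> uminus ` branch n ` V n"
proof
  show "V (Suc n) \<subseteq> branch n ` V n \<union> uminus ` branch n ` V n"
  proof
    fix x assume x: "x \<in> V (Suc n)"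
    have "x^2 = (branch n (x^2 + c n))^2" by (simp add: branch_power2)
    then have "x = branch n (x^2 + c n) \<or> x = - branch n (x^2 + c n)" by (simp add: power2_eq_iff)
    then show "x \<in> branch n ` V n \<union> uminus ` branch n ` V n" using x by (auto simp: V_Suc)
  qed
  show "branch n ` V n \<union> uminus ` branch n ` V n \<subseteq> V (Suc n)"
    by (auto simp: V_Suc branch_power2)
qed

lemma branch_neq_uminus_branch:
  assumes "\<alpha> \<in> V n" shows "branch n \<alpha> \<noteq> - branch n \<beta>"
proof
  assume *: "branch n \<alpha> = - branch n \<beta>"
  then have "(branch n \<alpha>)^2 = (branch n \<beta>)^2" by simp
  then have "\<alpha> = \<beta>" by (simp add: branch_power2)
  with * show False using uminus_neq_self[OF branch_nonzero[OF assms]] by simp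
qed

lemma V_Suc_Int: "branch n ` V n \<inter> uminus ` branch n ` V n = {}"
  using branch_neq_uminus_branch by auto

lemma finite_V: "finite (V n)"
  by (induction n) (auto simp: V_0 V_Suc_eq)

lemma V_nonempty: "V n \<noteq> {}"
  by (induction n) (auto simp: V_0 V_Suc_eq)

lemma even_card_V_Suc: "even (card (V (Suc n)))"
  by (simp add: V_Suc_eq card_Un_disjoint finite_V V_Suc_Int card_image inj_on_branch inj_on_def)

text \<open>The factors of the two children of each vertex combine to a difference of
  squares.\<close>

lemma prod_V_Suc: "(\<Prod>\<beta>\<in>V (Suc n). x - \<beta>) = (\<Prod>\<alpha>\<in>V n. x^2 + c n - \<alpha>)"
proof -
  have "(\<Prod>\<beta>\<in>V (Suc n). x - \<beta>) = (\<Prod>\<alpha>\<in>V n. x - branch n \<alpha>) * (\<Prod>\<alpha>\<in>V n. x + branch n \<alpha>)"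
    unfolding V_Suc_eq
    by (subst prod.union_disjoint) (simp_all add: finite_V V_Suc_Int prod.reindex inj_on_branch comp_def)
  also have "\<dots> = (\<Prod>\<alpha>\<in>V n. x^2 - (branch n \<alpha>)^2)"
    by (simp add: prod.distrib[symmetric] power2_eq_square algebra_simps)
  finally show ?thesis by (simp add: branch_power2 algebra_simps)
qed

definition branch_prod :: "nat \<Rightarrow> 'a" where
  "branch_prod n = (\<Prod>\<alpha>\<in>V n. branch n \<alpha>)"

lemma branch_prod_nonzero: "branch_prod n \<noteq> 0"
  by (simp add: branch_prod_def finite_V branch_nonzero)

text \<open>The index starts at 1 because level 0 has a single vertex, which would leave a sign -1;
  all later levels have even size.\<close>

lemma branch_prod_power2: "(branch_prod (Suc n))^2 = (\<Prod>\<alpha>\<in>V (Suc n). c (Suc n) - \<alpha>)"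
proof -
  have "(branch_prod (Suc n))^2 = (\<Prod>\<alpha>\<in>V (Suc n). - (c (Suc n) - \<alpha>))"
    by (simp add: branch_prod_def prod_power_distrib branch_power2)
  also have "\<dots> = (-1) ^ card (V (Suc n)) * (\<Prod>\<alpha>\<in>V (Suc n). c (Suc n) - \<alpha>)"
    by (rule prod_uminus)
  finally show ?thesis by (simp add: even_card_V_Suc)
qed

section \<open>Automorphisms of the tree with prescribed signs\<close>

definition verts :: "'a set" where "verts = (\<Union>n. V n)"

definition edges :: "'a set set" where
  "edges = {{\<alpha>, \<alpha>^2 + c m} | \<alpha> m. \<alpha> \<in> V (Suc m)}"

definition level :: "'a \<Rightarrow> nat" where "level x = (LEAST n. x \<in> V n)"

lemma level_eq: "x \<in> V n \<Longrightarrow> level x = n"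
  unfolding level_def by (metis LeastI V_unique)

text \<open>On each finite level injectivity gives surjectivity, and the disjoint levels can be
  glued.\<close>

lemma Bij_vertsI:
  assumes ext: "f \<in> extensional verts"
    and V: "\<And>n x. x \<in> V n \<Longrightarrow> f x \<in> V n"
    and inj: "\<And>n. inj_on f (V n)"
  shows "f \<in> Bij verts"
proof -
  have surj: "f ` V n = V n" for n
    using V by (intro endo_inj_surj finite_V inj) auto
  have "inj_on f verts"
  proof (rule inj_onI)
    fix x y assume "x \<in> verts" "y \<in> verts" and eq: "f x = f y"
    then obtain m n where mn: "x \<in> V m" "y \<in> V n" by (auto simp: verts_def)
    with eq V have "m = n" by (metis V_unique)
    with mn eq inj show "x = y" by (metis inj_onD)
  qed
  moreover have "f ` verts = verts" by (simp add: verts_def image_UN surj)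
  ultimately show ?thesis using ext by (simp add: Bij_def bij_betw_def)
qed

lemma edges_preserved:
  assumes f: "f \<in> Bij verts" and V: "\<And>n x. x \<in> V n \<Longrightarrow> f x \<in> V n"
    and parent: "\<And>n x. x \<in> V (Suc n) \<Longrightarrow> (f x)^2 + c n = f (x^2 + c n)"
    and xy: "x \<in> verts" "y \<in> verts"
  shows "{x, y} \<in> edges \<longleftrightarrow> {f x, f y} \<in> edges"
proof
  assume "{x, y} \<in> edges"
  then obtain \<alpha> m where am: "{x, y} = {\<alpha>, \<alpha>^2 + c m}" "\<alpha> \<in> V (Suc m)" by (auto simp: edges_def)
  have "{f x, f y} = f ` {x, y}" by simp
  also have "\<dots> = {f \<alpha>, (f \<alpha>)^2 + c m}" unfolding am(1) using parent[OF am(2)] by simp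
  finally show "{f x, f y} \<in> edges" using V[OF am(2)] unfolding edges_def by blast
next
  assume "{f x, f y} \<in> edges"
  then obtain \<beta> m where bm: "{f x, f y} = {\<beta>, \<beta>^2 + c m}" "\<beta> \<in> V (Suc m)" by (auto simp: edges_def)
  have inj: "inj_on f verts" using f by (simp add: Bij_def bij_betw_def)
  \<comment> \<open>The converse comes from injectivity: \<open>w\<close> and the parent of
    \<open>u\<close> have the same image. As edges are unordered, this is stated for both
    orders.\<close>
  have main: "{u, w} \<in> edges" if uw: "u \<in> verts" "w \<in> verts" "f u = \<beta>" "f w = \<beta>^2 + c m" for u w
  proof -
    have u: "u \<in> V (Suc m)" using uw bm(2) V by (metis V_unique UN_E verts_def)
    have "f w = f (u^2 + c m)" using parent[OF u] uw by simp
    moreover have "u^2 + c m \<in> verts" using u by (auto simp: V_Suc verts_def)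
    ultimately have "w = u^2 + c m" using inj uw(2) by (metis inj_onD)
    then show ?thesis using u unfolding edges_def by blast
  qed
  from bm(1) have "f x = \<beta> \<and> f y = \<beta>^2 + c m \<or> f y = \<beta> \<and> f x = \<beta>^2 + c m"
    by (auto simp: doubleton_eq_iff)
  then show "{x, y} \<in> edges" using main xy by (metis insert_commute)
qed

text \<open>
  The automorphism determined by prescribing for every vertex \<open>\<alpha>\<close> whether the two edges above
  it are interchanged relative to the marking by \<open>branch\<close>. Here \<open>x / branch n (x\<^sup>2 + c n)\<close> is the
  sign of \<open>x\<close> relative to that marking.
\<close>

primrec sign_aut_level :: "(nat \<Rightarrow> 'a \<Rightarrow> 'a) \<Rightarrow> nat \<Rightarrow> 'a \<Rightarrow> 'a" where
  "sign_aut_level e 0 x = x"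
| "sign_aut_level e (Suc n) x =
     e n (x^2 + c n) * (x / branch n (x^2 + c n)) * branch n (sign_aut_level e n (x^2 + c n))"

definition sign_aut :: "(nat \<Rightarrow> 'a \<Rightarrow> 'a) \<Rightarrow> 'a \<Rightarrow> 'a" where
  "sign_aut e = (\<lambda>x\<in>verts. sign_aut_level e (level x) x)"

lemma sign_aut_eq: "x \<in> V n \<Longrightarrow> sign_aut e x = sign_aut_level e n x"
  by (auto simp: sign_aut_def verts_def level_eq)

context
  fixes e :: "nat \<Rightarrow> 'a \<Rightarrow> 'a"
  assumes e_power2: "\<And>n \<alpha>. (e n \<alpha>)^2 = 1"
begin

text \<open>Both signs square to 1, so only the square of \<open>branch\<close> at the image of the
  parent survives.\<close>

lemma sign_aut_level_parent:
  assumes "x \<in> V (Suc n)"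
  shows "(sign_aut_level e (Suc n) x)^2 + c n = sign_aut_level e n (x^2 + c n)"
proof -
  have "(x / branch n (x^2 + c n))^2 = 1"
    using assms V_Suc_nonzero by (auto simp: power_divide branch_power2)
  then show ?thesis by (simp only: sign_aut_level.simps power_mult_distrib e_power2 branch_power2) simp
qed

lemma sign_aut_level_in_V: "x \<in> V n \<Longrightarrow> sign_aut_level e n x \<in> V n"
proof (induction n arbitrary: x)
  case (Suc n)
  then have "sign_aut_level e n (x^2 + c n) \<in> V n" by (simp add: V_Suc)
  then show ?case using sign_aut_level_parent[OF Suc.prems] V_Suc by auto
qed simp

lemma inj_on_sign_aut_level: "inj_on (sign_aut_level e n) (V n)"
proof (induction n)
  case (Suc n)
  show ?case
  proof (rule inj_onI)
    fix x y assume x: "x \<in> V (Suc n)" and y: "y \<in> V (Suc n)"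
      and eq: "sign_aut_level e (Suc n) x = sign_aut_level e (Suc n) y"
    let ?a = "x^2 + c n"
    have V: "?a \<in> V n" "y^2 + c n \<in> V n" using x y by (auto simp: V_Suc)
    have "sign_aut_level e n ?a = sign_aut_level e n (y^2 + c n)"
      using eq sign_aut_level_parent[OF x] sign_aut_level_parent[OF y] by simp
    then have y: "y^2 + c n = ?a" using Suc V by (metis inj_onD)
    have "e n ?a * (x / branch n ?a) * branch n (sign_aut_level e n ?a) =
          e n ?a * (y / branch n ?a) * branch n (sign_aut_level e n ?a)"
      using eq by (simp only: sign_aut_level.simps y)
    moreover have "e n ?a \<noteq> 0" using e_power2[of n ?a] by auto
    moreover have "branch n (sign_aut_level e n ?a) \<noteq> 0"
      using branch_nonzero sign_aut_level_in_V V by blast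
    ultimately show "x = y" using branch_nonzero[OF V(1)] by simp
  qed
qed (simp add: V_0)

lemma sign_aut_Bij: "sign_aut e \<in> Bij verts"
proof (rule Bij_vertsI)
  show "inj_on (sign_aut e) (V n)" for n
    using inj_on_sign_aut_level[of n] by (simp add: sign_aut_eq cong: inj_on_cong)
qed (simp_all add: sign_aut_eq sign_aut_level_in_V, simp add: sign_aut_def)

lemma sign_aut_in_V: "x \<in> V n \<Longrightarrow> sign_aut e x \<in> V n"
  by (simp add: sign_aut_eq sign_aut_level_in_V)

lemma sign_aut_edges:
  "x \<in> verts \<Longrightarrow> y \<in> verts \<Longrightarrow> {x, y} \<in> edges \<longleftrightarrow> {sign_aut e x, sign_aut e y} \<in> edges"
proof (rule edges_preserved[OF sign_aut_Bij sign_aut_in_V])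
  fix n x assume x: "x \<in> V (Suc n)"
  then have "x^2 + c n \<in> V n" by (simp add: V_Suc)
  with x show "(sign_aut e x)^2 + c n = sign_aut e (x^2 + c n)"
    using sign_aut_level_parent[OF x] by (simp only: sign_aut_eq)
qed

text \<open>A marked child goes to the marked child of the image vertex, times the prescribed sign;
  the image vertices merely permute the level.\<close>

lemma prod_sign_aut_branch:
  "(\<Prod>\<alpha>\<in>V n. sign_aut e (branch n \<alpha>)) = (\<Prod>\<alpha>\<in>V n. e n \<alpha>) * branch_prod n"
proof -
  have "(\<Prod>\<alpha>\<in>V n. sign_aut e (branch n \<alpha>)) = (\<Prod>\<alpha>\<in>V n. e n \<alpha> * branch n (sign_aut_level e n \<alpha>))"
    by (rule prod.cong) (simp_all add: sign_aut_eq[OF branch_in_V] branch_power2 branch_nonzero)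
  also have "\<dots> = (\<Prod>\<alpha>\<in>V n. e n \<alpha>) * (\<Prod>\<alpha>\<in>V n. branch n (sign_aut_level e n \<alpha>))"
    by (rule prod.distrib)
  also have "(\<Prod>\<alpha>\<in>V n. branch n (sign_aut_level e n \<alpha>)) = branch_prod n"
    unfolding branch_prod_def
  proof (rule prod.reindex_bij_betw)
    show "bij_betw (sign_aut_level e n) (V n) (V n)"
      using inj_on_sign_aut_level sign_aut_level_in_V finite_V
      by (metis bij_betw_def endo_inj_surj image_subsetI)
  qed
  finally show ?thesis .
qed

end

text \<open>Only one vertex of level \<open>k\<close> carries the sign -1. Flipping at the whole
  level would have no effect on \<open>branch_prod k\<close> for positive \<open>k\<close>, as the
  level has even size.\<close>

definition flip :: "nat \<Rightarrow> 'a \<Rightarrow> 'a" where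
  "flip k = sign_aut (\<lambda>n \<alpha>. if n = k \<and> \<alpha> = (SOME \<beta>. \<beta> \<in> V k) then -1 else 1)"

lemma flip_Bij: "flip k \<in> Bij verts"
  unfolding flip_def by (rule sign_aut_Bij) simp

lemma flip_in_V: "x \<in> V n \<Longrightarrow> flip k x \<in> V n"
  unfolding flip_def by (rule sign_aut_in_V) simp_all

lemma flip_edges:
  "x \<in> verts \<Longrightarrow> y \<in> verts \<Longrightarrow> {x, y} \<in> edges \<longleftrightarrow> {flip k x, flip k y} \<in> edges"
  unfolding flip_def by (rule sign_aut_edges) simp_all

lemma prod_flip_branch:
  "(\<Prod>\<alpha>\<in>V n. flip k (branch n \<alpha>)) = (if n = k then - branch_prod n else branch_prod n)"
proof -
  let ?b = "SOME \<beta>. \<beta> \<in> V k"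
  have b: "?b \<in> V k" using V_nonempty by (simp add: some_in_eq)
  have "(\<Prod>\<alpha>\<in>V n. if n = k \<and> \<alpha> = ?b then -1 else 1) = (if n = k then - 1 else (1::'a))"
    using b by (auto simp: finite_V)
  then show ?thesis unfolding flip_def by (subst prod_sign_aut_branch) auto
qed

end

section \<open>Irreducibility of the iterates\<close>

context
  fixes h :: "'a::comm_ring_1 \<Rightarrow> 'b::comm_ring_1"
  assumes hom: "h 0 = 0" "h 1 = 1" "\<And>a b. h (a + b) = h a + h b" "\<And>a b. h (a * b) = h a * h b"
begin

lemma poly_map_poly_pCons:
  "poly (map_poly h (pCons a p)) x = h a + x * poly (map_poly h p) x"
  by (simp add: map_poly_pCons hom)

lemma poly_map_poly_add:
  "poly (map_poly h (p + q)) x = poly (map_poly h p) x + poly (map_poly h q) x"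
  by (induction p q rule: poly_induct2) (simp_all add: poly_map_poly_pCons hom algebra_simps)

lemma poly_map_poly_smult:
  "poly (map_poly h (Polynomial.smult a p)) x = h a * poly (map_poly h p) x"
  by (induction p) (simp_all add: poly_map_poly_pCons hom algebra_simps)

lemma poly_map_poly_mult:
  "poly (map_poly h (p * q)) x = poly (map_poly h p) x * poly (map_poly h q) x"
  by (induction p)
    (simp_all add: poly_map_poly_pCons poly_map_poly_add poly_map_poly_smult hom algebra_simps)

lemma poly_map_poly_pcompose:
  "poly (map_poly h (p \<circ>\<^sub>p q)) x = poly (map_poly h p) (poly (map_poly h q) x)"
  by (induction p)
    (simp_all add: pcompose_pCons poly_map_poly_pCons poly_map_poly_add poly_map_poly_mult hom)

lemma poly_map_poly_quad: "poly (map_poly h (quad a)) x = x^2 + h a"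
  by (simp add: quad_def poly_map_poly_pCons hom power2_eq_square)

lemma poly_map_poly_seq_comp_Suc:
  "poly (map_poly h (seq_comp (\<lambda>n. quad (c n)) (Suc n))) x =
   poly (map_poly h (seq_comp (\<lambda>n. quad (c n)) n)) (x^2 + h (c n))"
  by (simp add: poly_map_poly_pcompose poly_map_poly_quad)

lemma poly_map_poly_ident: "poly (map_poly h [:0, 1:]) x = x"
  by (simp add: poly_map_poly_pCons hom)

lemma poly_map_poly_const: "poly (map_poly h p) (h x) = h (poly p x)"
  by (induction p) (simp_all add: poly_map_poly_pCons hom)

end

text \<open>Let \<open>i\<close> be the first index where \<open>p\<close> does not divide the
  coefficient of \<open>f\<close>. If \<open>g\<close> is not constant, then \<open>i\<close> is
  below the degree of the product, whose i-th coefficient is f_i g_0 modulo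
  \<open>p\<close>.\<close>

lemma eisenstein_aux:
  fixes f g :: "int poly" and p :: int
  assumes p: "Factorial_Ring.prime p"
    and lc: "\<not> p dvd Polynomial.lead_coeff (f * g)"
    and low: "\<And>i. i < Polynomial.degree (f * g) \<Longrightarrow> p dvd Polynomial.coeff (f * g) i"
    and f0: "p dvd Polynomial.coeff f 0" and g0: "\<not> p dvd Polynomial.coeff g 0"
  shows "Polynomial.degree g = 0"
proof (rule ccontr)
  assume g: "Polynomial.degree g \<noteq> 0"
  have "\<not> p dvd Polynomial.lead_coeff f" using lc by (auto simp: lead_coeff_mult)
  then have ex: "\<not> p dvd Polynomial.coeff f (Polynomial.degree f)" .
  define i where "i = (LEAST i. \<not> p dvd Polynomial.coeff f i)"
  have i: "\<not> p dvd Polynomial.coeff f i" unfolding i_def by (rule LeastI[of "\<lambda>i. \<not> p dvd Polynomial.coeff f i", OF ex])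
  have below: "p dvd Polynomial.coeff f j" if "j < i" for j
    using not_less_Least[of j "\<lambda>i. \<not> p dvd Polynomial.coeff f i"] that unfolding i_def by blast
  have "f \<noteq> 0" "g \<noteq> 0" using i g by auto
  then have "Polynomial.degree (f * g) = Polynomial.degree f + Polynomial.degree g"
    by (rule degree_mult_eq)
  moreover have "i \<le> Polynomial.degree f" unfolding i_def by (rule Least_le[of "\<lambda>i. \<not> p dvd Polynomial.coeff f i", OF ex])
  ultimately have "i < Polynomial.degree (f * g)" using g by simp
  from low[OF this] have "p dvd (\<Sum>j\<le>i. Polynomial.coeff f j * Polynomial.coeff g (i - j))"
    by (simp add: coeff_mult)
  moreover have "(\<Sum>j\<le>i. Polynomial.coeff f j * Polynomial.coeff g (i - j)) =
      (\<Sum>j<i. Polynomial.coeff f j * Polynomial.coeff g (i - j)) + Polynomial.coeff f i * Polynomial.coeff g 0"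
    by (simp add: lessThan_Suc_atMost[symmetric])
  moreover have "p dvd (\<Sum>j<i. Polynomial.coeff f j * Polynomial.coeff g (i - j))"
    by (intro dvd_sum) (simp add: below)
  ultimately have "p dvd Polynomial.coeff f i * Polynomial.coeff g 0"
    by (simp add: dvd_add_right_iff)
  then show False using p i g0 by (simp add: prime_dvd_mult_iff)
qed

text \<open>Exactly one of the two constant terms is divisible by \<open>p\<close>, so one of the
  two factors is constant by the previous lemma.\<close>

lemma eisenstein:
  fixes f g :: "int poly" and p :: int
  assumes p: "Factorial_Ring.prime p"
    and lc: "\<not> p dvd Polynomial.lead_coeff (f * g)"
    and low: "\<And>i. i < Polynomial.degree (f * g) \<Longrightarrow> p dvd Polynomial.coeff (f * g) i"
    and p2: "\<not> p^2 dvd Polynomial.coeff (f * g) 0"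
  shows "Polynomial.degree f = 0 \<or> Polynomial.degree g = 0"
proof (cases "Polynomial.degree (f * g) = 0")
  case True
  have "f \<noteq> 0" "g \<noteq> 0" using p2 by auto
  then show ?thesis using True by (simp add: degree_mult_eq)
next
  case False
  then have "p dvd Polynomial.coeff (f * g) 0" by (intro low) simp
  then have "p dvd Polynomial.coeff f 0 \<or> p dvd Polynomial.coeff g 0"
    using p by (simp add: coeff_mult prime_dvd_mult_iff)
  moreover have "\<not> (p dvd Polynomial.coeff f 0 \<and> p dvd Polynomial.coeff g 0)"
    using p2 by (auto simp: coeff_mult power2_eq_square intro: mult_dvd_mono)
  ultimately show ?thesis
    using eisenstein_aux[of p f g] eisenstein_aux[of p g f] p lc low by (auto simp: mult.commute)
qed

text \<open>Pseudo-division gives a f = P q + r over the integers, and r = 0 by minimality.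
  Comparing contents (Gauss's lemma) shows that \<open>a\<close> divides \<open>q\<close> and
  cancels.\<close>

lemma primitive_minimal_poly_dvd:
  fixes x :: "'a::field_char_0" and f P :: "int poly"
  assumes P: "P \<noteq> 0" "Polynomial.content P = 1" "poly (map_poly of_int P) x = 0"
    and min: "\<And>q. q \<noteq> 0 \<Longrightarrow> poly (map_poly of_int q) x = 0 \<Longrightarrow> Polynomial.degree P \<le> Polynomial.degree q"
    and f: "poly (map_poly of_int f) x = 0"
  shows "P dvd f"
proof -
  obtain q r where qr: "pseudo_divmod f P = (q, r)" by fastforce
  obtain a where a: "Polynomial.smult a f = P * q + r" "a \<noteq> 0"
    using pseudo_divmod(1)[OF P(1) qr] P(1) by (metis leading_coeff_0_iff power_not_zero)
  have "poly (map_poly of_int (P * q + r)) x = (0::'a)"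
    unfolding a(1)[symmetric] by (subst poly_map_poly_smult) (simp_all add: f)
  then have "poly (map_poly of_int r) x = 0"
    by (simp add: poly_map_poly_add poly_map_poly_mult P(3))
  then have "r = 0" using pseudo_divmod(2)[OF P(1) qr] min[of r] by fastforce
  with a have eq: "Polynomial.smult a f = P * q" by simp
  then have "Polynomial.content (Polynomial.smult a f) = Polynomial.content (P * q)" by simp
  then have "\<bar>a\<bar> * Polynomial.content f = Polynomial.content q" by (simp add: content_mult P(2))
  then have "a dvd Polynomial.content q" by (metis abs_dvd_iff dvd_triv_left)
  then obtain q' where "q = [:a:] * q'" by (metis const_poly_dvd_iff_dvd_content dvdE)
  with eq have "Polynomial.smult a f = Polynomial.smult a (P * q')" by simp
  then have "Polynomial.smult a (f - P * q') = 0" by (simp add: smult_diff_right)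
  then have "f = P * q'" using a(2) by (metis smult_eq_0_iff right_minus_eq)
  then show ?thesis by simp
qed

text \<open>Both polynomials are constant multiples of a primitive polynomial of least degree that
  vanishes at \<open>x\<close>.\<close>

lemma common_root_degree_eq:
  fixes x :: "'a::field_char_0" and f g :: "int poly"
  assumes f: "f \<noteq> 0" "poly (map_poly of_int f) x = 0"
      "\<And>p q. p * q = f \<Longrightarrow> Polynomial.degree p = 0 \<or> Polynomial.degree q = 0"
    and g: "g \<noteq> 0" "poly (map_poly of_int g) x = 0"
      "\<And>p q. p * q = g \<Longrightarrow> Polynomial.degree p = 0 \<or> Polynomial.degree q = 0"
  shows "Polynomial.degree f = Polynomial.degree g"
proof -
  let ?R = "\<lambda>q. q \<noteq> 0 \<and> poly (map_poly of_int q) x = 0"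
  obtain p where p: "?R p" and min: "\<And>q. ?R q \<Longrightarrow> Polynomial.degree p \<le> Polynomial.degree q"
    using ex_has_least_nat[of ?R f Polynomial.degree] f by blast
  define P where "P = primitive_part p"
  have "poly (map_poly of_int (Polynomial.smult (Polynomial.content p) P)) x = 0"
    using p by (simp add: P_def)
  then have P: "P \<noteq> 0" "Polynomial.content P = 1" "poly (map_poly of_int P) x = 0"
    using p by (subst (asm) poly_map_poly_smult; simp add: P_def)+
  have minP: "Polynomial.degree P \<le> Polynomial.degree q" if "q \<noteq> 0" "poly (map_poly of_int q) x = 0" for q
    using min[of q] that by (simp add: P_def)
  have P_pos: "Polynomial.degree P \<noteq> 0"
  proof
    assume "Polynomial.degree P = 0"
    then obtain a where "P = [:a:]" by (rule degree_eq_zeroE)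
    then show False using P by (simp add: map_poly_pCons)
  qed
  have deg: "Polynomial.degree k = Polynomial.degree P"
    if k: "k \<noteq> 0" "poly (map_poly of_int k) x = 0"
      "\<And>p q. p * q = k \<Longrightarrow> Polynomial.degree p = 0 \<or> Polynomial.degree q = 0" for k
  proof -
    obtain q where q: "k = P * q" using primitive_minimal_poly_dvd[OF P minP k(2)] by auto
    then have "Polynomial.degree q = 0" using k(3)[of P q] P_pos by auto
    moreover have "q \<noteq> 0" using q k(1) by auto
    ultimately show ?thesis using P(1) q by (simp add: degree_mult_eq)
  qed
  show ?thesis using deg[OF f] deg[OF g] by simp
qed

section \<open>Iterates whose constants are 1 or 2 modulo 4, as -2, -3 and -6 are\<close>

context
  fixes c :: "nat \<Rightarrow> int"
  assumes c_mod_4: "\<And>n. c n mod 4 \<in> {1, 2}"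
begin

abbreviation (input) "int_comp \<equiv> seq_comp (\<lambda>n. quad (c n))"

lemma degree_int_comp: "Polynomial.degree (int_comp n) = 2 ^ n"
  by (induction n) (simp_all add: degree_pcompose quad_def)

lemma lead_coeff_int_comp: "Polynomial.lead_coeff (int_comp n) = 1"
  by (induction n) (simp_all add: lead_coeff_comp quad_def)

text \<open>Squares are 0 or 1 modulo 4, so the sum is 1, 2 or 3. This supplies the condition on p^2
  in Eisenstein's criterion.\<close>

lemma square_plus_mod_4: "(y^2 + c n) mod 4 \<noteq> 0"
proof -
  have "y mod 4 \<in> {0, 1, 2, 3}" by auto
  then have "(y mod 4)^2 mod 4 \<in> {0, 1}" by auto
  then have "y^2 mod 4 \<in> {0, 1}" by (simp add: power_mod)
  moreover have "(y^2 + c n) mod 4 = (y^2 mod 4 + c n mod 4) mod 4" by (simp add: mod_add_eq)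
  ultimately show ?thesis using c_mod_4[of n] by auto
qed

lemma int_comp_mod_4: "y mod 4 \<noteq> 0 \<Longrightarrow> poly (int_comp n) y mod 4 \<noteq> 0"
  by (induction n arbitrary: y) (simp_all add: poly_pcompose square_plus_mod_4)

lemma int_comp_Suc_mod_4: "poly (int_comp (Suc n)) y mod 4 \<noteq> 0"
  by (simp add: poly_pcompose int_comp_mod_4 square_plus_mod_4)

lemma add_smult_2_power: "\<exists>s. (a + Polynomial.smult 2 r) ^ k = a ^ k + Polynomial.smult 2 (s :: int poly)"
proof (induction k)
  case (Suc k)
  then obtain s where "(a + Polynomial.smult 2 r) ^ k = a ^ k + Polynomial.smult 2 s" by blast
  then have "(a + Polynomial.smult 2 r) ^ Suc k = a ^ Suc k + Polynomial.smult 2 (r * a ^ k + a * s + Polynomial.smult 2 (r * s))"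
    by (simp add: algebra_simps smult_add_right)
  then show ?case by blast
qed (auto intro: exI[of _ 0])

text \<open>Modulo 2 squaring is additive, so x^2 + c - e is the square of a linear polynomial, and
  the iterate is a pure power.\<close>

lemma int_comp_mod_2: "\<exists>e q. int_comp n = [:- e, 1:] ^ (2 ^ n) + Polynomial.smult 2 q"
proof (induction n)
  case 0
  show ?case by (rule exI[of _ 0], rule exI[of _ 0]) simp
next
  case (Suc n)
  then obtain e q where IH: "int_comp n = [:- e, 1:] ^ (2 ^ n) + Polynomial.smult 2 q" by blast
  define e' where "e' = c n - e"
  have "even (e' - e'^2)" by auto
  then obtain k where k: "e' - e'^2 = 2 * k" by blast
  have "[:- e, 1:] \<circ>\<^sub>p quad (c n) = [:- e', 1:]^2 + Polynomial.smult 2 [:k, e':]"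
    using k by (simp add: quad_def e'_def pcompose_pCons power2_eq_square algebra_simps)
  then obtain s where s: "([:- e, 1:] \<circ>\<^sub>p quad (c n)) ^ (2 ^ n) = ([:- e', 1:]^2) ^ (2 ^ n) + Polynomial.smult 2 s"
    using add_smult_2_power by metis
  have pow: "(p ^ k) \<circ>\<^sub>p r = (p \<circ>\<^sub>p r) ^ k" for p r :: "int poly" and k
    by (induction k) (simp_all add: pcompose_mult pcompose_1)
  have "int_comp (Suc n) = [:- e', 1:] ^ (2 ^ Suc n) + Polynomial.smult 2 (s + q \<circ>\<^sub>p quad (c n))"
    by (simp add: IH pcompose_add pow s pcompose_smult smult_add_right power_mult[symmetric])
  then show ?case by blast
qed

lemma int_comp_irreducible:
  assumes "f * g = int_comp n"
  shows "Polynomial.degree f = 0 \<or> Polynomial.degree g = 0"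
proof (cases n)
  case 0
  have "Polynomial.degree (f * g) = 1" using degree_int_comp[of n] 0 assms by simp
  moreover have "f \<noteq> 0" "g \<noteq> 0" using calculation by auto
  ultimately have "Polynomial.degree f + Polynomial.degree g = 1" by (simp add: degree_mult_eq)
  then show ?thesis by auto
next
  case (Suc m)
  obtain e q where eq: "int_comp n = [:- e, 1:] ^ (2 ^ n) + Polynomial.smult 2 q"
    using int_comp_mod_2 by blast
  \<comment> \<open>Translation by \<open>e\<close> turns the power into x^(2^n) modulo 2, ready for
    Eisenstein's criterion. The new constant term is the iterate at \<open>e\<close>, which is not
    divisible by 4 for positive \<open>n\<close>.\<close>
  let ?t = "[:e, 1:] :: int poly"
  let ?h = "int_comp n \<circ>\<^sub>p ?t"
  have fg: "(f \<circ>\<^sub>p ?t) * (g \<circ>\<^sub>p ?t) = ?h" by (simp add: pcompose_mult[symmetric] assms)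
  have pow: "(p ^ k) \<circ>\<^sub>p r = (p \<circ>\<^sub>p r) ^ k" for p r :: "int poly" and k
    by (induction k) (simp_all add: pcompose_mult pcompose_1)
  have "?h = ([:- e, 1:] \<circ>\<^sub>p ?t) ^ (2 ^ n) + Polynomial.smult 2 (q \<circ>\<^sub>p ?t)"
    unfolding eq by (simp add: pcompose_add pcompose_smult pow)
  also have "[:- e, 1:] \<circ>\<^sub>p ?t = Polynomial.monom 1 1" by (simp add: pcompose_pCons monom_altdef)
  finally have h: "?h = Polynomial.monom 1 (2 ^ n) + Polynomial.smult 2 (q \<circ>\<^sub>p ?t)"
    by (simp add: monom_power)
  have deg: "Polynomial.degree ?h = 2 ^ n" by (simp add: degree_pcompose degree_int_comp)
  have lc: "Polynomial.lead_coeff ?h = 1" by (simp add: lead_coeff_comp lead_coeff_int_comp)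
  have coeff: "even (Polynomial.coeff ?h i)" if "i < 2 ^ n" for i
    using that by (simp add: h)
  have c0: "Polynomial.coeff ?h 0 mod 4 \<noteq> 0"
    using int_comp_Suc_mod_4[of m e] Suc by (simp add: pcompose_coeff_0)
  have "Polynomial.degree (f \<circ>\<^sub>p ?t) = 0 \<or> Polynomial.degree (g \<circ>\<^sub>p ?t) = 0"
  proof (rule eisenstein[of 2])
    show "\<not> 2 dvd Polynomial.lead_coeff (f \<circ>\<^sub>p ?t * g \<circ>\<^sub>p ?t)" unfolding fg lc by simp
    show "\<not> 2^2 dvd Polynomial.coeff (f \<circ>\<^sub>p ?t * g \<circ>\<^sub>p ?t) 0" unfolding fg using c0 by (simp add: dvd_eq_mod_eq_0)
  qed (simp_all only: fg deg coeff, simp)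
  then show ?thesis by (simp add: degree_pcompose)
qed

lemma int_comp_common_root:
  fixes x :: "'a::field_char_0"
  assumes "poly (map_poly of_int (int_comp m)) x = 0" "poly (map_poly of_int (int_comp n)) x = 0"
  shows "m = n"
proof -
  have "Polynomial.degree (int_comp m) = Polynomial.degree (int_comp n)"
    using assms lead_coeff_int_comp[of m] lead_coeff_int_comp[of n]
    by (intro common_root_degree_eq[of _ x]) (auto dest: int_comp_irreducible)
  then show ?thesis by (simp add: degree_int_comp)
qed

end

lemma ac_roots_0: "ac_roots (seq_comp \<gamma> 0) = {0}"
  by (auto simp: ac_roots_def poly_map_poly_ident)

lemma ac_roots_Suc:
  assumes "\<gamma> = (\<lambda>n. quad (c n))"
  shows "ac_roots (seq_comp \<gamma> (Suc n)) = {x. x^2 + to_ac (c n) \<in> ac_roots (seq_comp \<gamma> n)}"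
  unfolding ac_roots_def assms by (subst poly_map_poly_seq_comp_Suc) simp_all

lemma ac_roots_seq_comp_disjoint:
  fixes c :: "nat \<Rightarrow> int"
  assumes c: "\<And>n. c n mod 4 \<in> {1, 2}" and \<gamma>: "\<gamma> = (\<lambda>n. quad (of_int (c n) :: 'a::field_char_0))"
    and "m \<noteq> n"
  shows "ac_roots (seq_comp \<gamma> m) \<inter> ac_roots (seq_comp \<gamma> n) = {}"
proof -
  have eq: "poly (map_poly to_ac (seq_comp \<gamma> n)) x =
      poly (map_poly of_int (seq_comp (\<lambda>n. quad (c n)) n)) x" for n and x :: "'a alg_closure"
    unfolding \<gamma>
  proof (induction n arbitrary: x)
    case (Suc n)
    show ?case
      by (subst (1 2) poly_map_poly_seq_comp_Suc) (simp_all add: Suc.IH)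
  qed (simp add: poly_map_poly_ident)
  show ?thesis using int_comp_common_root[of c, OF c] \<open>m \<noteq> n\<close> by (auto simp: ac_roots_def eq)
qed

section \<open>The arboreal representation\<close>

lemma splitting_field_to_ac: "to_ac a \<in> splitting_field f"
  and splitting_field_root: "x \<in> ac_roots f \<Longrightarrow> x \<in> splitting_field f"
  unfolding splitting_field_def by (auto intro: generate_field.incl)

lemma splitting_field_add:
  "x \<in> splitting_field f \<Longrightarrow> y \<in> splitting_field f \<Longrightarrow> x + y \<in> splitting_field f"
  using generate_field.eng_add[of x ring_of_type_algebra _ y]
  unfolding splitting_field_def by (simp add: ring_of_type_algebra_def)

lemma splitting_field_mult:
  "x \<in> splitting_field f \<Longrightarrow> y \<in> splitting_field f \<Longrightarrow> x * y \<in> splitting_field f"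
  using generate_field.eng_mult[of x ring_of_type_algebra _ y]
  unfolding splitting_field_def by (simp add: ring_of_type_algebra_def)

lemma splitting_field_prod:
  "(\<And>i. i \<in> A \<Longrightarrow> u i \<in> splitting_field f) \<Longrightarrow> prod u A \<in> splitting_field f"
  using splitting_field_to_ac[of 1 f]
  by (induction A rule: infinite_finite_induct) (auto intro: splitting_field_mult)

lemma splitting_field_mono:
  assumes "ac_roots f \<subseteq> splitting_field g"
  shows "splitting_field f \<subseteq> splitting_field g"
proof -
  interpret field "ring_of_type_algebra :: 'a alg_closure ring"
    by (rule field_from_type_algebra)
  have carrier: "carrier (ring_of_type_algebra :: 'a alg_closure ring) = UNIV"
    by (simp add: ring_of_type_algebra_def)
  have "subfield (splitting_field g) ring_of_type_algebra"
    unfolding splitting_field_def by (rule generate_field_is_subfield) (simp add: carrier)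
  then show ?thesis
    unfolding splitting_field_def[of f]
    by (rule generate_field_min_subfield1[rotated])
       (use assms in \<open>auto simp: carrier splitting_field_to_ac\<close>)
qed

lemma Gal_bij_betw: "\<sigma> \<in> carrier (Gal L) \<Longrightarrow> bij_betw \<sigma> L L"
  by (simp add: Gal_def Bij_def)

lemma Gal_to_ac: "\<sigma> \<in> carrier (Gal L) \<Longrightarrow> \<sigma> (to_ac a) = to_ac a"
  by (simp add: Gal_def)

lemma Gal_ring_iso:
  "\<sigma> \<in> carrier (Gal L) \<Longrightarrow>
   \<sigma> \<in> ring_iso (ring_of_type_algebra\<lparr>carrier := L\<rparr>) (ring_of_type_algebra\<lparr>carrier := L\<rparr>)"
  by (simp add: Gal_def)

lemma Gal_mult: "\<sigma> \<in> carrier (Gal L) \<Longrightarrow> x \<in> L \<Longrightarrow> y \<in> L \<Longrightarrow> \<sigma> (x * y) = \<sigma> x * \<sigma> y"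
  using ring_iso_memE(2)[OF Gal_ring_iso, of \<sigma> L x y] by (simp add: ring_of_type_algebra_def)

lemma Gal_add: "\<sigma> \<in> carrier (Gal L) \<Longrightarrow> x \<in> L \<Longrightarrow> y \<in> L \<Longrightarrow> \<sigma> (x + y) = \<sigma> x + \<sigma> y"
  using ring_iso_memE(3)[OF Gal_ring_iso, of \<sigma> L x y] by (simp add: ring_of_type_algebra_def)

lemma Gal_minus:
  assumes "\<sigma> \<in> carrier (Gal (splitting_field f))" "x \<in> splitting_field f"
  shows "\<sigma> (- x) = - \<sigma> x"
  using Gal_mult[OF assms(1) splitting_field_to_ac[of "-1"] assms(2)]
  by (simp add: Gal_to_ac[OF assms(1), of "-1", simplified])

lemma Gal_prod:
  assumes "\<sigma> \<in> carrier (Gal (splitting_field f))" and "\<And>i. i \<in> A \<Longrightarrow> u i \<in> splitting_field f"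
  shows "\<sigma> (prod u A) = (\<Prod>i\<in>A. \<sigma> (u i))"
  using assms(2) Gal_to_ac[OF assms(1), of 1]
  by (induction A rule: infinite_finite_induct)
    (simp_all add: Gal_mult[OF assms(1)] splitting_field_prod)

lemma id_Gal: "(\<lambda>x\<in>splitting_field f. x) \<in> carrier (Gal (splitting_field f))"
  unfolding Gal_def
  by (auto simp: id_Bij splitting_field_to_ac splitting_field_add splitting_field_mult
      ring_of_type_algebra_def bij_betw_def inj_on_def intro!: ring_iso_memI
      intro: splitting_field_to_ac[of 1, simplified])

locale arboreal_tower =
  fixes c :: "nat \<Rightarrow> 'a::field_char_0" and \<gamma> :: "nat \<Rightarrow> 'a poly"
  assumes \<gamma>_quad: "\<gamma> = (\<lambda>n. quad (c n))"
    and ac_roots_disjoint: "m \<noteq> n \<Longrightarrow> ac_roots (seq_comp \<gamma> m) \<inter> ac_roots (seq_comp \<gamma> n) = {}"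

sublocale arboreal_tower \<subseteq> quadratic_tower "\<lambda>n. to_ac (c n)" "\<lambda>n. ac_roots (seq_comp \<gamma> n)"
  by standard (simp_all add: ac_roots_0 ac_roots_Suc[OF \<gamma>_quad] ac_roots_disjoint del: seq_comp.simps)

context arboreal_tower
begin

abbreviation "V n \<equiv> ac_roots (seq_comp \<gamma> n)"

abbreviation "L n \<equiv> splitting_field (seq_comp \<gamma> n)"

lemma tree_verts_eq: "tree_verts \<gamma> = verts"
proof (rule Set.set_eqI)
  fix x
  have "x \<in> tree_verts \<gamma> \<longleftrightarrow> x \<in> V 0 \<or> (\<exists>m\<ge>1. x \<in> V m)"
    unfolding tree_verts_def V_0 by blast
  also have "\<dots> \<longleftrightarrow> (\<exists>m. x \<in> V m)" by (metis less_one not_le)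
  finally show "x \<in> tree_verts \<gamma> \<longleftrightarrow> x \<in> verts" by (simp add: verts_def)
qed

lemma tree_edges_eq: "tree_edges \<gamma> = edges"
proof -
  have "poly (map_poly to_ac (\<gamma> m)) x = x^2 + to_ac (c m)" for m x
    unfolding \<gamma>_quad by (rule poly_map_poly_quad) simp_all
  then show ?thesis by (simp add: tree_edges_def edges_def del: seq_comp.simps)
qed

lemma prod_poly: "poly (map_poly to_ac (seq_comp \<gamma> n)) x = (\<Prod>\<alpha>\<in>V n. x - \<alpha>)"
proof (induction n arbitrary: x)
  case 0
  show ?case unfolding V_0 by (simp add: poly_map_poly_ident)
next
  case (Suc n)
  have "poly (map_poly to_ac (seq_comp \<gamma> (Suc n))) x =
      poly (map_poly to_ac (seq_comp \<gamma> n)) (x^2 + to_ac (c n))"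
    unfolding \<gamma>_quad by (rule poly_map_poly_seq_comp_Suc) simp_all
  then show ?case by (simp only: Suc prod_V_Suc)
qed

text \<open>The product over level n + 1 is the iterate of index n + 1 at \<open>c (Suc n)\<close>,
  and this point is the image of 0 under \<open>\<gamma> (Suc n)\<close>; hence the index n +
  2.\<close>

lemma branch_prod_power2_eq:
  "(branch_prod (Suc n))^2 = to_ac (poly (seq_comp \<gamma> (Suc (Suc n))) 0)"
proof -
  have "(branch_prod (Suc n))^2 = poly (map_poly to_ac (seq_comp \<gamma> (Suc n))) (to_ac (c (Suc n)))"
    by (simp only: branch_prod_power2 prod_poly)
  also have "\<dots> = to_ac (poly (seq_comp \<gamma> (Suc n)) (c (Suc n)))"
    by (rule poly_map_poly_const) simp_all
  also have "poly (seq_comp \<gamma> (Suc n)) (c (Suc n)) = poly (seq_comp \<gamma> (Suc (Suc n))) 0"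
    by (subst (2) seq_comp.simps(2)) (simp add: poly_pcompose \<gamma>_quad del: seq_comp.simps)
  finally show ?thesis .
qed

lemma V_subset_L_Suc: "V n \<subseteq> L (Suc n)"
proof
  fix x assume "x \<in> V n"
  then have "branch n x \<in> L (Suc n)" by (intro splitting_field_root branch_in_V)
  then have "branch n x * branch n x + to_ac (c n) \<in> L (Suc n)"
    by (intro splitting_field_add splitting_field_mult splitting_field_to_ac)
  then show "x \<in> L (Suc n)" using branch_power2[of n x] by (simp add: power2_eq_square)
qed

lemma L_mono: "m \<le> n \<Longrightarrow> L m \<subseteq> L n"
  by (rule lift_Suc_mono_le[of L]) (auto intro: splitting_field_mono[OF V_subset_L_Suc, THEN subsetD] simp del: seq_comp.simps)

section \<open>The action of the inverse limit on the tree\<close>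

context
  fixes \<sigma> assumes \<sigma>: "\<sigma> \<in> carrier (Gal_lim \<gamma>)"
begin

lemma \<sigma>_Gal: "\<sigma> n \<in> carrier (Gal (L n))"
  using \<sigma> by (auto simp: Gal_lim_def Gal_n_def)

lemma \<sigma>_compat: "m \<le> n \<Longrightarrow> x \<in> L m \<Longrightarrow> \<sigma> n x = \<sigma> m x"
  using \<sigma> by (simp add: Gal_lim_def) (metis restrict_apply')

lemma \<sigma>_in_V: "x \<in> V n \<Longrightarrow> \<sigma> n x \<in> V n"
proof (induction n arbitrary: x)
  case 0
  then show ?case using Gal_to_ac[OF \<sigma>_Gal, of 0 0] unfolding V_0 by simp
next
  case (Suc n)
  have x: "x \<in> L (Suc n)" using Suc.prems by (rule splitting_field_root)
  have y: "x^2 + to_ac (c n) \<in> V n" using Suc.prems unfolding V_Suc by simp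
  have "(\<sigma> (Suc n) x)^2 + to_ac (c n) = \<sigma> (Suc n) (x * x + to_ac (c n))"
    using x by (simp add: Gal_add[OF \<sigma>_Gal] Gal_mult[OF \<sigma>_Gal] Gal_to_ac[OF \<sigma>_Gal]
        splitting_field_mult splitting_field_to_ac power2_eq_square del: seq_comp.simps)
  also have "\<dots> = \<sigma> n (x^2 + to_ac (c n))"
    unfolding power2_eq_square[symmetric] using y by (intro \<sigma>_compat splitting_field_root) simp_all
  also have "\<dots> \<in> V n" by (rule Suc.IH[OF y])
  finally show ?case unfolding V_Suc by simp
qed

text \<open>As the levels are disjoint, the least index in \<open>arboreal_rep\<close> is the level
  of \<open>x\<close>.\<close>

lemma arboreal_rep_eq: "x \<in> V n \<Longrightarrow> arboreal_rep \<gamma> \<sigma> x = \<sigma> n x"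
  using level_eq[of x n] by (auto simp: arboreal_rep_def tree_verts_eq level_def verts_def)

lemma arboreal_rep_Bij: "arboreal_rep \<gamma> \<sigma> \<in> Bij verts"
proof (rule Bij_vertsI)
  show "arboreal_rep \<gamma> \<sigma> \<in> extensional verts"
    by (simp add: arboreal_rep_def tree_verts_eq)
  show "inj_on (arboreal_rep \<gamma> \<sigma>) (V n)" for n
  proof -
    have "inj_on (\<sigma> n) (L n)" using Gal_bij_betw[OF \<sigma>_Gal] by (simp add: bij_betw_def)
    then have "inj_on (\<sigma> n) (V n)" by (rule inj_on_subset) (auto intro: splitting_field_root)
    then show ?thesis by (simp add: arboreal_rep_eq cong: inj_on_cong)
  qed
qed (simp add: arboreal_rep_eq \<sigma>_in_V)

end

text \<open>This puts every \<open>flip k\<close> into its own coset.\<close>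

lemma id_in_arboreal_image: "(\<lambda>x\<in>verts. x) \<in> arboreal_image \<gamma>"
proof -
  define \<iota> where "\<iota> = (\<lambda>n. \<lambda>x\<in>L n. x)"
  have \<iota>: "\<iota> \<in> carrier (Gal_lim \<gamma>)"
  proof -
    have "\<iota> n \<in> carrier (Gal (L n))" for n by (simp add: \<iota>_def id_Gal)
    moreover have "restrict (\<iota> n) (L m) = \<iota> m" if "m \<le> n" for m n
      using L_mono[OF that] by (auto simp: \<iota>_def fun_eq_iff)
    ultimately show ?thesis by (simp add: Gal_lim_def Gal_n_def PiE_UNIV_domain)
  qed
  have "arboreal_rep \<gamma> \<iota> = (\<lambda>x\<in>verts. x)"
  proof
    fix x show "arboreal_rep \<gamma> \<iota> x = (\<lambda>x\<in>verts. x) x"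
    proof (cases "x \<in> verts")
      case True
      then obtain n where n: "x \<in> V n" by (auto simp: verts_def)
      then show ?thesis using True splitting_field_root[OF n] arboreal_rep_eq[OF \<iota> n]
        by (simp add: \<iota>_def)
    qed (simp add: arboreal_rep_def tree_verts_eq)
  qed
  with \<iota> show ?thesis unfolding arboreal_image_def by (metis image_eqI)
qed

lemma flip_in_tree_Aut: "flip k \<in> carrier (tree_Aut \<gamma>)"
  using flip_Bij flip_edges by (simp add: tree_Aut_def tree_verts_eq tree_edges_eq)

lemma tree_Aut_mult:
  "f \<in> Bij verts \<Longrightarrow> g \<in> Bij verts \<Longrightarrow> f \<otimes>\<^bsub>tree_Aut \<gamma>\<^esub> g = compose verts f g"
  by (simp add: tree_Aut_def tree_verts_eq BijGroup_def)

lemma same_rcoset_flip: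
  assumes "arboreal_image \<gamma> #>\<^bsub>tree_Aut \<gamma>\<^esub> flip n = arboreal_image \<gamma> #>\<^bsub>tree_Aut \<gamma>\<^esub> flip m"
  obtains \<sigma> where "\<sigma> \<in> carrier (Gal_lim \<gamma>)"
    "\<And>x. x \<in> verts \<Longrightarrow> flip n x = arboreal_rep \<gamma> \<sigma> (flip m x)"
proof -
  have "(\<lambda>x\<in>verts. x) \<otimes>\<^bsub>tree_Aut \<gamma>\<^esub> flip n = flip n"
    using flip_Bij[of n] by (simp add: tree_Aut_mult id_Bij Bij_imp_funcset Bij_imp_extensional)
  then have "flip n \<in> arboreal_image \<gamma> #>\<^bsub>tree_Aut \<gamma>\<^esub> flip n"
    using id_in_arboreal_image unfolding r_coset_def by force
  then have "flip n \<in> arboreal_image \<gamma> #>\<^bsub>tree_Aut \<gamma>\<^esub> flip m" by (simp only: assms)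
  then obtain \<sigma> where \<sigma>: "\<sigma> \<in> carrier (Gal_lim \<gamma>)"
    and eq: "flip n = arboreal_rep \<gamma> \<sigma> \<otimes>\<^bsub>tree_Aut \<gamma>\<^esub> flip m"
    by (auto simp: r_coset_def arboreal_image_def)
  have "flip n = compose verts (arboreal_rep \<gamma> \<sigma>) (flip m)"
    using eq tree_Aut_mult[OF arboreal_rep_Bij[OF \<sigma>] flip_Bij] by simp
  then show ?thesis using that[OF \<sigma>] by (metis compose_eq)
qed

lemma branch_in_L: "\<alpha> \<in> V k \<Longrightarrow> branch k \<alpha> \<in> L (Suc k)"
  by (intro splitting_field_root branch_in_V)

lemma branch_prod_in_L: "branch_prod k \<in> L (Suc k)"
  unfolding branch_prod_def by (intro splitting_field_prod branch_in_L)

text \<open>For k \<noteq> m, the factors \<open>flip m (branch k \<alpha>)\<close> multiply to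
  \<open>branch_prod k\<close>. Applying \<open>\<sigma>\<close> turns them into
  \<open>flip n (branch k \<alpha>)\<close>, which brings in the sign exactly for k = n.\<close>

lemma \<sigma>_branch_prod:
  assumes \<sigma>: "\<sigma> \<in> carrier (Gal_lim \<gamma>)"
    and eq: "\<And>x. x \<in> verts \<Longrightarrow> flip n x = arboreal_rep \<gamma> \<sigma> (flip m x)"
    and "n \<noteq> m" "k \<noteq> m"
  shows "\<sigma> (Suc k) (branch_prod k) = (if k = n then - branch_prod k else branch_prod k)"
proof -
  have V: "flip m (branch k \<alpha>) \<in> V (Suc k)" if "\<alpha> \<in> V k" for \<alpha>
    using that by (intro flip_in_V branch_in_V)
  have "\<sigma> (Suc k) (\<Prod>\<alpha>\<in>V k. flip m (branch k \<alpha>)) = (\<Prod>\<alpha>\<in>V k. \<sigma> (Suc k) (flip m (branch k \<alpha>)))"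
    by (rule Gal_prod[OF \<sigma>_Gal[OF \<sigma>]]) (intro splitting_field_root V)
  also have "\<dots> = (\<Prod>\<alpha>\<in>V k. flip n (branch k \<alpha>))"
  proof (rule prod.cong)
    fix \<alpha> assume \<alpha>: "\<alpha> \<in> V k"
    then have "branch k \<alpha> \<in> verts" using branch_in_V[OF \<alpha>] unfolding verts_def by blast
    then show "\<sigma> (Suc k) (flip m (branch k \<alpha>)) = flip n (branch k \<alpha>)"
      using eq arboreal_rep_eq[OF \<sigma> V[OF \<alpha>]] by simp
  qed simp
  finally show ?thesis using \<open>k \<noteq> m\<close> by (simp add: prod_flip_branch del: seq_comp.simps)
qed

lemma infinite_index:
  assumes inf: "infinite I" and sq: "\<And>k. k \<in> I \<Longrightarrow> (branch_prod k)^2 = d"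
  shows "\<not> finite_index_arboreal \<gamma>"
proof
  let ?coset = "\<lambda>k. arboreal_image \<gamma> #>\<^bsub>tree_Aut \<gamma>\<^esub> flip k"
  assume "finite_index_arboreal \<gamma>"
  moreover have "?coset ` I \<subseteq> rcosets\<^bsub>tree_Aut \<gamma>\<^esub> (arboreal_image \<gamma>)"
    using flip_in_tree_Aut by (auto simp: RCOSETS_def)
  ultimately have "finite (?coset ` I)"
    unfolding finite_index_arboreal_def by (rule rev_finite_subset)
  then obtain k where "infinite {j \<in> I. ?coset j = ?coset k}"
    using pigeonhole_infinite[OF inf] by blast
  \<comment> \<open>Two indices \<open>n\<close> and \<open>m\<close> of the same coset produce
    \<open>\<sigma>\<close>; it negates \<open>branch_prod n\<close> and fixes
    \<open>branch_prod l\<close> for the third index. As these two elements agree up to sign, this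
    is impossible.\<close>
  then obtain T where T: "card T = 3" "T \<subseteq> {j \<in> I. ?coset j = ?coset k}"
    using infinite_arbitrarily_large by blast
  then obtain l m n where lmn: "T = {l, m, n}" "l \<noteq> m" "m \<noteq> n" "l \<noteq> n"
    by (auto simp: card_3_iff)
  have "?coset n = ?coset m" using T lmn by auto
  then obtain \<sigma> where \<sigma>: "\<sigma> \<in> carrier (Gal_lim \<gamma>)"
    and eq: "\<And>x. x \<in> verts \<Longrightarrow> flip n x = arboreal_rep \<gamma> \<sigma> (flip m x)"
    using same_rcoset_flip by metis
  define M where "M = Suc (max l n)"
  have L: "branch_prod l \<in> L M" "branch_prod n \<in> L M"
    using branch_prod_in_L[of l] branch_prod_in_L[of n] L_mono[of "Suc l" M] L_mono[of "Suc n" M]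
    by (auto simp: M_def simp del: seq_comp.simps)
  have "\<sigma> M (branch_prod l) = branch_prod l"
    using \<sigma>_compat[OF \<sigma> _ branch_prod_in_L, of l M] \<sigma>_branch_prod[OF \<sigma> eq, of l] lmn by (simp add: M_def)
  moreover have "\<sigma> M (branch_prod n) = - branch_prod n"
    using \<sigma>_compat[OF \<sigma> _ branch_prod_in_L, of n M] \<sigma>_branch_prod[OF \<sigma> eq, of n] lmn by (simp add: M_def)
  moreover have "branch_prod l = branch_prod n \<or> branch_prod l = - branch_prod n"
    using sq[of l] sq[of n] T lmn by (auto simp: power2_eq_iff)
  ultimately have "branch_prod n = - branch_prod n"
    using Gal_minus[OF \<sigma>_Gal[OF \<sigma>] L(2)] by auto
  then show False using uminus_neq_self[OF branch_prod_nonzero] by simp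
qed

end

section \<open>The exceptional sequences\<close>

lemma infinite_index_of_finite_postcritical_values:
  fixes c :: "nat \<Rightarrow> int" and \<gamma> :: "nat \<Rightarrow> 'a::field_char_0 poly"
  assumes c: "\<And>n. c n mod 4 \<in> {1, 2}" and \<gamma>: "\<gamma> = (\<lambda>n. quad (of_int (c n)))"
    and F: "finite F" and inf: "infinite {n. poly (seq_comp \<gamma> n) 0 \<in> F}"
  shows "\<not> finite_index_arboreal \<gamma>"
proof -
  interpret arboreal_tower "\<lambda>n. of_int (c n)" \<gamma>
    by (rule arboreal_tower.intro[OF \<gamma> ac_roots_seq_comp_disjoint[OF c \<gamma>]])
  define I where "I = {k. poly (seq_comp \<gamma> (Suc (Suc k))) 0 \<in> F}"
  \<comment> \<open>The formula for the square of \<open>branch_prod\<close> reaches only iterates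
    of index 2 or more, so the first two are split off.\<close>
  have "{n. poly (seq_comp \<gamma> n) 0 \<in> F} \<subseteq> {0, 1} \<union> (\<lambda>k. Suc (Suc k)) ` I"
  proof
    fix n assume n: "n \<in> {n. poly (seq_comp \<gamma> n) 0 \<in> F}"
    show "n \<in> {0, 1} \<union> (\<lambda>k. Suc (Suc k)) ` I"
    proof (cases "n < 2")
      case False
      then obtain k where "n = Suc (Suc k)" by (metis add_2_eq_Suc le_Suc_ex not_less)
      moreover from this n have "k \<in> I" unfolding I_def by (simp only: mem_Collect_eq)
      ultimately show ?thesis by blast
    qed auto
  qed
  then have "infinite I" using inf by (meson finite_Un finite_imageI finite.intros finite_subset)
  moreover have "finite ((\<lambda>k. poly (seq_comp \<gamma> (Suc (Suc k))) 0) ` I)"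
    by (rule finite_subset[OF _ F]) (auto simp: I_def)
  ultimately obtain k0 where
    "infinite {k \<in> I. poly (seq_comp \<gamma> (Suc (Suc k))) 0 = poly (seq_comp \<gamma> (Suc (Suc k0))) 0}"
    using pigeonhole_infinite by blast
  then have "infinite (Suc ` {k \<in> I. poly (seq_comp \<gamma> (Suc (Suc k))) 0 = poly (seq_comp \<gamma> (Suc (Suc k0))) 0})"
    by (simp add: finite_image_iff)
  then show ?thesis
  proof (rule infinite_index)
    fix k assume "k \<in> Suc ` {k \<in> I. poly (seq_comp \<gamma> (Suc (Suc k))) 0 = poly (seq_comp \<gamma> (Suc (Suc k0))) 0}"
    then obtain j where j: "k = Suc j"
      and eq: "poly (seq_comp \<gamma> (Suc (Suc j))) 0 = poly (seq_comp \<gamma> (Suc (Suc k0))) 0" by blast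
    show "(branch_prod k)^2 = to_ac (poly (seq_comp \<gamma> (Suc (Suc k0))) 0)"
      unfolding j branch_prod_power2_eq eq ..
  qed
qed

lemma infinite_index_of_infinitely_often:
  fixes d :: int and \<gamma> :: "nat \<Rightarrow> 'a::field_char_0 poly"
  assumes d: "d \<in> {- 2, - 3, - 6}"
    and \<gamma>: "\<gamma> \<in> UNIV \<rightarrow> {quad (- 2), quad (of_int d)}" and inf: "infinite {n. \<gamma> n = quad (- 2)}"
  shows "\<not> finite_index_arboreal \<gamma>"
proof -
  define c where "c n = (if \<gamma> n = quad (- 2) then - 2 else d)" for n
  \<comment> \<open>A finite set that contains -2 and is mapped into itself by both polynomials. A
    last step x^2 - 2 sends 0 to -2, so the value of the iterate at 0 stays in it.\<close>
  define F :: "'a set" where "F = (if d = - 6 then {2, - 2} else {1, - 1, 2, - 2})"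
  have \<gamma>c: "\<gamma> n = quad (of_int (c n))" for n
    using \<gamma> by (auto simp: c_def dest: funcset_mem)
  have cmod: "c n mod 4 \<in> {1, 2}" for n using d by (auto simp: c_def)
  have F: "y^2 + of_int (c n) \<in> F" if "y \<in> F" for y n
    using that d by (auto simp: F_def c_def split: if_splits)
  have seq: "poly (seq_comp \<gamma> n) y \<in> F" if "y \<in> F" for n y
    using that
  proof (induction n arbitrary: y)
    case (Suc n)
    have "poly (\<gamma> n) y \<in> F" using F[OF Suc.prems] by (simp add: \<gamma>c)
    then show ?case using Suc.IH by (simp add: poly_pcompose)
  qed simp
  have "poly (seq_comp \<gamma> (Suc n)) 0 \<in> F" if "\<gamma> n = quad (- 2)" for n
    using seq[of "- 2" n] that by (simp add: poly_pcompose F_def)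
  then have "Suc ` {n. \<gamma> n = quad (- 2)} \<subseteq> {n. poly (seq_comp \<gamma> n) 0 \<in> F}" by blast
  moreover have "infinite (Suc ` {n. \<gamma> n = quad (- 2)})" using inf by (simp add: finite_image_iff)
  ultimately have inf': "infinite {n. poly (seq_comp \<gamma> n) 0 \<in> F}" by (meson finite_subset)
  have "\<gamma> = (\<lambda>n. quad (of_int (c n)))" by (rule ext) (rule \<gamma>c)
  moreover have "finite F" by (simp add: F_def)
  ultimately show ?thesis
    using inf' by (rule infinite_index_of_finite_postcritical_values[OF cmod])
qed

text \<open>Such a sequence is determined by the finite set of positions where it equals
  \<open>a\<close>.\<close>

lemma countable_finitely_often: "countable {\<gamma> \<in> UNIV \<rightarrow> {a, b}. finite {n::nat. \<gamma> n = a}}"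
proof (rule countable_image_inj_on)
  let ?A = "{\<gamma> \<in> UNIV \<rightarrow> {a, b}. finite {n::nat. \<gamma> n = a}}"
  let ?s = "\<lambda>\<gamma>. {n::nat. \<gamma> n = a}"
  show "countable (?s ` ?A)"
    by (rule countable_subset[OF _ countable_Collect_finite]) auto
  show "inj_on ?s ?A"
  proof (rule inj_onI)
    fix \<gamma> \<delta> assume "\<gamma> \<in> ?A" "\<delta> \<in> ?A" and eq: "?s \<gamma> = ?s \<delta>"
    then have ab: "\<gamma> n \<in> {a, b}" "\<delta> n \<in> {a, b}" for n by auto
    show "\<gamma> = \<delta>"
    proof
      fix n
      have "\<gamma> n = a \<longleftrightarrow> \<delta> n = a" using eq by blast
      then show "\<gamma> n = \<delta> n" using ab[of n] by auto
    qed
  qed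
qed

text \<open>By the chain rule 0 is a critical point of the iterate, hence a multiple root.\<close>

lemma not_separable_if_critical_root:
  fixes \<gamma> :: "nat \<Rightarrow> 'a::field_char_0 poly"
  assumes \<gamma>: "\<gamma> n = quad c" and 0: "poly (seq_comp \<gamma> (Suc n)) 0 = 0"
  shows "\<not> separable_poly (seq_comp \<gamma> (Suc n))"
proof -
  let ?p = "map_poly to_ac (seq_comp \<gamma> (Suc n))" and ?q = "map_poly to_ac (seq_comp \<gamma> n)"
  have "poly ?p x = poly (?q \<circ>\<^sub>p quad (to_ac c)) x" for x
  proof -
    have "poly ?p x = poly ?q (poly (map_poly to_ac (quad c)) x)"
      unfolding seq_comp.simps \<gamma> by (rule poly_map_poly_pcompose) simp_all
    also have "poly (map_poly to_ac (quad c)) x = x^2 + to_ac c"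
      by (rule poly_map_poly_quad) simp_all
    finally show ?thesis by (simp add: poly_pcompose)
  qed
  then have "?p = ?q \<circ>\<^sub>p quad (to_ac c)" by (metis ext poly_eq_poly_eq_iff)
  then have "poly (pderiv ?p) 0 = 0" by (simp add: pderiv_pcompose quad_def pderiv_pCons)
  moreover have "poly ?p 0 = 0"
    using poly_map_poly_const[of to_ac "seq_comp \<gamma> (Suc n)" 0] 0 by simp
  ultimately show ?thesis unfolding separable_poly_def rsquarefree_roots by blast
qed

lemma Phi_sep_0_1:
  assumes S: "S \<subseteq> {quad 0, quad (- 1)}"
  shows "Phi_sep (S :: 'a::field_char_0 poly set) \<subseteq> {\<lambda>n. if n = 0 then quad (- 1) else quad 0}"
proof
  fix \<gamma> assume "\<gamma> \<in> Phi_sep S"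
  then have mem: "\<gamma> n = quad 0 \<or> \<gamma> n = quad (- 1)" and sep: "separable_poly (seq_comp \<gamma> n)" for n
    using S by (auto simp: Phi_sep_def)
  have nz: "poly (seq_comp \<gamma> (Suc n)) 0 \<noteq> 0" for n
    using not_separable_if_critical_root[of \<gamma> n] mem[of n] sep by metis
  have \<gamma>0: "\<gamma> 0 = quad (- 1)" using nz[of 0] mem[of 0] by (auto simp: poly_pcompose)
  have \<gamma>_pos: "\<gamma> n = quad 0" if "n \<ge> 1" for n
    using that
  proof (induction n rule: less_induct)
    case (less n)
    \<comment> \<open>The first map x^2 - 1 kills 1 and -1, and the squarings applied before it send
      both to 1. A second x^2 - 1 would send 0 to -1 and so make 0 a root.\<close>
    have zero: "poly (seq_comp \<gamma> (Suc k)) y = 0" if "Suc k \<le> n" "y \<in> {1, - 1}" for k y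
      using that
    proof (induction k arbitrary: y)
      case 0
      then show ?case by (auto simp: \<gamma>0 poly_pcompose)
    next
      case (Suc k)
      have "\<gamma> (Suc k) = quad 0" using Suc.prems by (intro less.IH) auto
      moreover have "y^2 = 1" using Suc.prems by auto
      ultimately show ?case
        using Suc.IH[of 1] Suc.prems(1) by (subst seq_comp.simps) (simp add: poly_pcompose del: seq_comp.simps)
    qed
    obtain k where k: "n = Suc k" using less.prems by (metis Suc_le_D One_nat_def)
    show ?case
    proof (rule ccontr)
      assume "\<gamma> n \<noteq> quad 0"
      then have "poly (seq_comp \<gamma> (Suc n)) 0 = poly (seq_comp \<gamma> n) (- 1)"
        using mem[of n] by (auto simp: poly_pcompose)
      then show False using zero[of k "- 1"] nz[of n] k by simp
    qed
  qed
  show "\<gamma> \<in> {\<lambda>n. if n = 0 then quad (- 1) else quad 0}"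
    using \<gamma>0 \<gamma>_pos by (auto simp: fun_eq_iff)
qed

text \<open>Countability suffices if \<open>S\<close> has two elements. For a singleton the product
  measure is a point mass, so emptiness is required.\<close>

lemma exceptional_set:
  assumes "S \<in> special_sets"
  defines "E \<equiv> {\<gamma> \<in> Phi_sep S. finite_index_arboreal \<gamma>}"
  shows "countable E" and "S = {a} \<Longrightarrow> E = {}"
proof -
  have *: "E \<subseteq> {\<gamma> \<in> UNIV \<rightarrow> {quad (- 2), quad (of_int d)}. finite {n. \<gamma> n = quad (- 2)}}"
    if "d \<in> {- 2, - 3, - 6}" "S \<subseteq> {quad (- 2), quad (of_int d)}" for d
    using infinite_index_of_infinitely_often[OF that(1)] that(2) by (auto simp: E_def Phi_sep_def)
  have ex: "(\<exists>d \<in> {- 2, - 3, - 6 :: int}. S \<subseteq> {quad (- 2), quad (of_int d)}) \<or> S \<subseteq> {quad 0, quad (- 1)}"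
    using assms(1) unfolding special_sets_def by (elim insertE emptyE; fastforce)
  then show "countable E"
  proof
    assume "\<exists>d \<in> {- 2, - 3, - 6 :: int}. S \<subseteq> {quad (- 2), quad (of_int d)}"
    then obtain d where d: "d \<in> {- 2, - 3, - 6 :: int}" "S \<subseteq> {quad (- 2), quad (of_int d)}" by blast
    show ?thesis by (rule countable_subset[OF *[OF d] countable_finitely_often])
  next
    assume "S \<subseteq> {quad 0, quad (- 1)}"
    then have "E \<subseteq> {\<lambda>n. if n = 0 then quad (- 1) else quad 0}" using Phi_sep_0_1 by (auto simp: E_def)
    then show ?thesis by (rule countable_subset) simp
  qed
  assume Sa: "S = {a}"
  have const: "\<gamma> n = a" if "\<gamma> \<in> E" for \<gamma> n using that Sa by (auto simp: E_def Phi_sep_def)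
  have "a = quad (- 2) \<or> S \<subseteq> {quad 0, quad (- 1)}"
    using assms(1) Sa unfolding special_sets_def by (elim insertE emptyE) auto
  then show "E = {}"
  proof
    assume "a = quad (- 2)"
    then have "S \<subseteq> {quad (- 2), quad (of_int (- 2))}" by (simp add: Sa)
    from *[OF _ this] have "finite {n. \<gamma> n = a}" if "\<gamma> \<in> E" for \<gamma>
      using that \<open>a = quad (- 2)\<close> by blast
    with const show ?thesis by auto
  next
    assume "S \<subseteq> {quad 0, quad (- 1)}"
    then have "E \<subseteq> {\<lambda>n. if n = 0 then quad (- 1) else quad 0}" using Phi_sep_0_1 by (auto simp: E_def)
    \<comment> \<open>The only candidate takes different values at 0 and 1, whereas a sequence in a
      singleton is constant.\<close>
    then show ?thesis using const[of _ 0] const[of _ 1] by fastforce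
  qed
qed

text \<open>With two points of positive mass, the largest point mass \<open>q\<close> is below 1.
  The measure of a single sequence is the limit of products bounded by \<open>q ^ Suc n\<close>,
  hence 0.\<close>

lemma (in sequence_space) countable_null_sets_PiM:
  assumes fin: "finite (space M)" and sets: "sets M = Pow (space M)"
    and pos: "\<And>x. x \<in> space M \<Longrightarrow> measure M {x} > 0"
    and two: "a \<in> space M" "b \<in> space M" "a \<noteq> b"
    and A: "countable A" "A \<subseteq> UNIV \<rightarrow> space M"
  shows "A \<in> null_sets (\<Pi>\<^sub>M i\<in>(UNIV::nat set). M)"
proof -
  define q where "q = Max ((\<lambda>x. measure M {x}) ` space M)"
  have le_q: "measure M {x} \<le> q" if "x \<in> space M" for x
    using that fin by (simp add: q_def)
  obtain z where z: "z \<in> space M" "q = measure M {z}"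
    using Max_in[of "(\<lambda>x. measure M {x}) ` space M"] fin two(1) unfolding q_def
    by (metis (no_types, lifting) empty_iff finite_imageI image_iff image_is_empty)
  obtain y where y: "y \<in> space M" "y \<noteq> z" using two by metis
  have "measure M {z} + measure M {y} = measure M {z, y}"
    using y z by (subst M.finite_measure_Union[symmetric]) (auto simp: sets insert_commute)
  also have "\<dots> \<le> 1" by simp
  finally have q: "0 \<le> q" "q < 1" using pos[OF y(1)] z(2) by auto
  have "{\<gamma>} \<in> null_sets S" if \<gamma>: "\<gamma> \<in> UNIV \<rightarrow> space M" for \<gamma>
  proof -
    have sing: "{\<gamma>} = Pi UNIV (\<lambda>n. {\<gamma> n})" by (auto simp: fun_eq_iff)
    have E: "{\<gamma> n} \<in> sets M" for n using \<gamma> by (auto simp: sets)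
    have "(\<lambda>n. \<Prod>i\<le>n. measure M {\<gamma> i}) \<longlonglongrightarrow> measure S {\<gamma>}"
      unfolding sing using measure_PiM_countable[OF E] .
    moreover have "(\<lambda>n. \<Prod>i\<le>n. measure M {\<gamma> i}) \<longlonglongrightarrow> 0"
    proof (rule tendsto_sandwich[OF always_eventually always_eventually])
      show "\<forall>n. 0 \<le> (\<Prod>i\<le>n. measure M {\<gamma> i})" by (simp add: prod_nonneg)
      show "\<forall>n. (\<Prod>i\<le>n. measure M {\<gamma> i}) \<le> q ^ Suc n"
      proof
        fix n
        have "(\<Prod>i\<le>n. measure M {\<gamma> i}) \<le> (\<Prod>i\<le>n. q)"
          using \<gamma> le_q by (intro prod_mono) auto
        then show "(\<Prod>i\<le>n. measure M {\<gamma> i}) \<le> q ^ Suc n" by simp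
      qed
      show "(\<lambda>n. q ^ Suc n) \<longlonglongrightarrow> 0"
        using LIMSEQ_power_zero[of q] q by (intro LIMSEQ_Suc) auto
    qed simp
    ultimately have "measure S {\<gamma>} = 0" by (rule LIMSEQ_unique)
    moreover have "{\<gamma>} \<in> sets S" unfolding sing using E by (rule infprod_in_sets)
    ultimately show ?thesis by (auto simp: null_sets_def emeasure_eq_measure)
  qed
  then have "(\<Union>\<gamma>\<in>A. {\<gamma>}) \<in> null_sets S" using A by (intro null_sets_UN') auto
  then show ?thesis by simp
qed

lemma exceptional_null_set:
  fixes \<nu> :: "rat poly measure"
  assumes special: "S \<in> special_sets" and fin: "finite S"
    and \<nu>: "prob_space \<nu>" "space \<nu> = S" "sets \<nu> = Pow S"
    and pos: "\<And>\<phi>. \<phi> \<in> S \<Longrightarrow> measure \<nu> {\<phi>} > 0"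
  shows "{\<gamma> \<in> Phi_sep S. finite_index_arboreal \<gamma>} \<in> null_sets (\<Pi>\<^sub>M i\<in>(UNIV :: nat set). \<nu>)"
proof -
  interpret prob_space \<nu> by (rule \<nu>(1))
  interpret sequence_space \<nu> ..
  obtain a where a: "a \<in> S" using prob_space.not_empty[OF \<nu>(1)] \<nu>(2) by blast
  show ?thesis
  proof (cases "S = {a}")
    case True
    show ?thesis unfolding exceptional_set(2)[OF special True] by (rule null_sets.empty_sets)
  next
    case False
    then obtain b where "b \<in> S" "b \<noteq> a" using a by blast
    then show ?thesis
      using a exceptional_set(1)[OF special] fin \<nu> pos
      by (intro countable_null_sets_PiM[of a b]) (auto simp: Phi_sep_def)
  qed
qed

theorem theorem1p1:
  fixes C :: "rat set" and S :: "rat poly set" and \<nu> :: "rat poly measure"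
  assumes "finite C" and "S = quad ` C"
    and "prob_space \<nu>" and "space \<nu> = S" and "sets \<nu> = Pow S"
    and "\<And>\<phi>. \<phi> \<in> S \<Longrightarrow> measure \<nu> {\<phi>} > 0"
  shows "((\<exists>P\<in>Orb S 0. finite_orbit_point S P) \<longrightarrow> S \<in> special_sets) \<and>
    (S \<in> special_sets \<longrightarrow>
      {\<gamma> \<in> Phi_sep S. finite_index_arboreal \<gamma>} \<in> null_sets (\<Pi>\<^sub>M i\<in>(UNIV :: nat set). \<nu>)) \<and>
    ((\<exists>P\<in>Orb S 0. finite_orbit_point S P) \<longrightarrow>
      {\<gamma> \<in> Phi_sep S. finite_index_arboreal \<gamma>} \<in> null_sets (\<Pi>\<^sub>M i\<in>(UNIV :: nat set). \<nu>))"
proof -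
  \<comment> \<open>An empty \<open>C\<close> would have finite orbits without being one of the six
    cases; it is excluded because a probability space is nonempty.\<close>
  have "C \<noteq> {}" using prob_space.not_empty[OF assms(3)] assms(2,4) by auto
  then have 1: "(\<exists>P\<in>Orb S 0. finite_orbit_point S P) \<longrightarrow> S \<in> special_sets"
    using finite_orbit_imp_special assms(2) by blast
  have 2: "S \<in> special_sets \<longrightarrow>
      {\<gamma> \<in> Phi_sep S. finite_index_arboreal \<gamma>} \<in> null_sets (\<Pi>\<^sub>M i\<in>(UNIV :: nat set). \<nu>)"
    using assms by (intro impI exceptional_null_set) auto
  show ?thesis using 1 2 by blast
qed

end
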